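(* Let $(M,\tau)$ be a von Neumann algebra with a faithful normal tracial state, let $X=(x_1,\ldots,x_n)\in M^n$ be an $n$-tuple of self-adjoint operators, and let $S=(s_1,\ldots,s_n)\in M^n$ be a free $(0,1)$-semicircular $n$-tuple, free from $X$. Let $\rho>0$, let $d(t)=t-\log(1+t)$ for $t>-1$, and for a free $(0,\rho^{-1})$-semicircular $n$-tuple $Z$ write $\Delta^*(X,Z)=\chi^*(X\mid V_\rho)-\chi^*(Z\mid V_\rho)$. Then $$\Phi^*(X\mid V_\rho)-2\rho\,\Delta^*\!\left(X,\tfrac{1}{\sqrt\rho}S\right)\ \ge\ n\rho\cdot d\!\left(\frac{\Phi^*(X)}{n\rho}-1\right).$$
   Context: Setting: $\langle a,b\rangle_2=\tau(b^*a)$ on $M$, with completion $L^2(M)$; $W^*(X)$ is the von Neumann algebra generated by $x_1,\dots,x_n$; $\langle\cdot,\cdot\rangle_{HS}$ is the inner product of $L^2(M\bar\otimes M^{op},\tau\otimes\tau^{op})$. $\mathscr P$ is the algebra of complex noncommutative polynomials in self-adjoint indeterminates $t_1,\dots,t_n$; $p(X)$ denotes evaluation $t_j\mapsto x_j$. The free difference quotients are the linear maps with $\partial_j m=\sum_{m=a t_j b}a\otimes b^{op}$ on monomials $m$, and $[\partial_jp](X)$ is evaluation at $X$ in both tensor legs. A free $(0,\sigma^2)$-semicircular $n$-tuple is an $n$-tuple of freely independent semicircular operators, each with mean $0$ and variance $\sigma^2$; thus $\frac{1}{\sqrt\rho}S$ is a free $(0,\rho^{-1})$-semicircular $n$-tuple.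 $V_\rho=\frac{\rho}{2}\sum_{j=1}^n t_j^2$. Conjugate variables to $X$: vectors $\xi_1,\dots,\xi_n\in L^2(W^*(X))$ with $\langle\xi_j,p(X)\rangle_2=\langle 1\otimes1^{op},[\partial_jp](X)\rangle_{HS}$ for all $p\in\mathscr P$ and all $j$. Free Fisher information: $\Phi^*(X)=\sum_j\|\xi_j\|_2^2$ and $\Phi^*(X\mid V_\rho)=\sum_j\|\xi_j-\rho x_j\|_2^2$ if the conjugate variables exist; both are $+\infty$ otherwise. Non-microstates free entropy: $\chi^*(X)=\frac12\int_0^\infty\left(\frac{n}{1+t}-\Phi^*(X+\sqrt t\,S')\right)dt+\frac n2\log(2\pi e)$, with $S'$ a free $(0,1)$-semicircular $n$-tuple free from $X$. Relative version: $\chi^*(X\mid V_\rho)=\frac{\rho}{2}\sum_j\tau(x_j^2)-\chi^*(X)$. *)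

theory Defs
  imports "HOL-Analysis.Analysis" "HOL-Library.Poly_Mapping"
begin

section \<open>Operators on a complex Hilbert space\<close>

text \<open>The underlying real structure comes from the library, so that a bounded operator is a
  complex linear element of \<^typ>\<open>'h \<Rightarrow>\<^sub>L 'h\<close>.  The inner product is linear in the first argument.\<close>

class chilbert_space = real_inner + complete_space +
  fixes scaleC :: "complex \<Rightarrow> 'a \<Rightarrow> 'a" (infixr "*\<^sub>C" 75)
    and cinner :: "'a \<Rightarrow> 'a \<Rightarrow> complex"
  assumes scaleC_add_right: "c *\<^sub>C (x + y) = c *\<^sub>C x + c *\<^sub>C y"
    and scaleC_add_left: "(c + d) *\<^sub>C x = c *\<^sub>C x + d *\<^sub>C x"
    and scaleC_scaleC: "c *\<^sub>C d *\<^sub>C x = (c * d) *\<^sub>C x"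
    and scaleC_of_real: "of_real r *\<^sub>C x = r *\<^sub>R x"
    and cinner_add_left: "cinner (x + y) z = cinner x z + cinner y z"
    and cinner_scaleC_left: "cinner (c *\<^sub>C x) y = c * cinner x y"
    and cinner_commute: "cinner x y = cnj (cinner y x)"
    and Re_cinner: "Re (cinner x y) = inner x y"

type_synonym 'h op = "'h \<Rightarrow>\<^sub>L 'h"

definition complex_linear :: "'h::chilbert_space op \<Rightarrow> bool" where
  "complex_linear a \<longleftrightarrow> (\<forall>c x. blinfun_apply a (c *\<^sub>C x) = c *\<^sub>C blinfun_apply a x)"

definition scale_op :: "complex \<Rightarrow> 'h::chilbert_space op \<Rightarrow> 'h op" where
  "scale_op c a = Blinfun (\<lambda>x. c *\<^sub>C blinfun_apply a x)"

definition adj :: "'h::chilbert_space op \<Rightarrow> 'h op" where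
  "adj a = (THE b. \<forall>x y. cinner (blinfun_apply a x) y = cinner x (blinfun_apply b y))"

definition commutant :: "'h::chilbert_space op set \<Rightarrow> 'h op set" where
  "commutant A = {b. complex_linear b \<and> (\<forall>a\<in>A. a o\<^sub>L b = b o\<^sub>L a)}"

section \<open>Tracial von Neumann algebras\<close>

definition von_neumann_algebra :: "'h::chilbert_space op set \<Rightarrow> bool" where
  "von_neumann_algebra M \<longleftrightarrow>
     (\<forall>a\<in>M. complex_linear a \<and> adj a \<in> M) \<and> commutant (commutant M) = M"

definition vN_generated :: "'h::chilbert_space op set \<Rightarrow> 'h op set" where
  "vN_generated A = \<Inter>{N. von_neumann_algebra N \<and> A \<subseteq> N}"

text \<open>Normality is continuity for the ultraweak topology, whose continuous functionals are the
  sums of vector functionals over square summable sequences of vectors.\<close>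

definition normal_on :: "'h::chilbert_space op set \<Rightarrow> ('h op \<Rightarrow> complex) \<Rightarrow> bool" where
  "normal_on M \<tau> \<longleftrightarrow>
     (\<exists>h g :: nat \<Rightarrow> 'h. summable (\<lambda>k. (norm (h k))\<^sup>2) \<and> summable (\<lambda>k. (norm (g k))\<^sup>2) \<and>
        (\<forall>a\<in>M. (\<lambda>k. cinner (blinfun_apply a (h k)) (g k)) sums \<tau> a))"

definition tracial_vN_algebra :: "'h::chilbert_space op set \<Rightarrow> ('h op \<Rightarrow> complex) \<Rightarrow> bool" where
  "tracial_vN_algebra M \<tau> \<longleftrightarrow>
     von_neumann_algebra M \<and>
     (\<forall>a\<in>M. \<forall>b\<in>M. \<tau> (a + b) = \<tau> a + \<tau> b) \<and>
     (\<forall>c. \<forall>a\<in>M. \<tau> (scale_op c a) = c * \<tau> a) \<and>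
     \<tau> id_blinfun = 1 \<and>
     (\<forall>a\<in>M. Im (\<tau> (adj a o\<^sub>L a)) = 0 \<and> 0 \<le> Re (\<tau> (adj a o\<^sub>L a))) \<and>
     (\<forall>a\<in>M. \<tau> (adj a o\<^sub>L a) = 0 \<longrightarrow> a = 0) \<and>
     (\<forall>a\<in>M. \<forall>b\<in>M. \<tau> (a o\<^sub>L b) = \<tau> (b o\<^sub>L a)) \<and>
     normal_on M \<tau>"

text \<open>Tuples are indexed by a finite type \<^typ>\<open>'n\<close>, so they have \<open>CARD('n) \<ge> 1\<close> entries.\<close>

definition sa_tuple :: "'h::chilbert_space op set \<Rightarrow> ('n::finite \<Rightarrow> 'h op) \<Rightarrow> bool" where
  "sa_tuple M X \<longleftrightarrow> (\<forall>j. X j \<in> M \<and> adj (X j) = X j)"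

abbreviation W_star :: "('n::finite \<Rightarrow> 'h::chilbert_space op) \<Rightarrow> 'h op set" where
  "W_star X \<equiv> vN_generated (range X)"

section \<open>Vectors of the L2-completion\<close>

text \<open>The completion of an algebra \<open>A\<close> for \<open>\<langle>a,b\<rangle> = \<tau>(b* a)\<close> is given by Cauchy sequences.  Two
  sequences represent the same vector iff the 2-norms of their differences tend to 0;
  only quantities depending on the represented vectors are used, so no quotient is formed.
  An element of the algebra is the constant sequence.\<close>

definition inner2 :: "('h::chilbert_space op \<Rightarrow> complex) \<Rightarrow> 'h op \<Rightarrow> 'h op \<Rightarrow> complex" where
  "inner2 \<tau> a b = \<tau> (adj b o\<^sub>L a)"

definition norm2 :: "('h::chilbert_space op \<Rightarrow> complex) \<Rightarrow> 'h op \<Rightarrow> real" where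
  "norm2 \<tau> a = sqrt (Re (inner2 \<tau> a a))"

definition L2_vectors ::
    "('h::chilbert_space op \<Rightarrow> complex) \<Rightarrow> 'h op set \<Rightarrow> (nat \<Rightarrow> 'h op) set" where
  "L2_vectors \<tau> A = {\<xi>. (\<forall>k. \<xi> k \<in> A) \<and>
     (\<forall>e>0. \<exists>N. \<forall>k\<ge>N. \<forall>l\<ge>N. norm2 \<tau> (\<xi> k - \<xi> l) < e)}"

definition L2_inner ::
    "('h::chilbert_space op \<Rightarrow> complex) \<Rightarrow> (nat \<Rightarrow> 'h op) \<Rightarrow> (nat \<Rightarrow> 'h op) \<Rightarrow> complex" where
  "L2_inner \<tau> \<xi> \<eta> = lim (\<lambda>k. inner2 \<tau> (\<xi> k) (\<eta> k))"

definition L2_norm :: "('h::chilbert_space op \<Rightarrow> complex) \<Rightarrow> (nat \<Rightarrow> 'h op) \<Rightarrow> real" where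
  "L2_norm \<tau> \<xi> = lim (\<lambda>k. norm2 \<tau> (\<xi> k))"

section \<open>Noncommutative polynomials and free difference quotients\<close>

text \<open>A monomial is the list of its letters, and a polynomial is a finitely supported family of
  coefficients.  An element of the tensor product of the polynomials with their opposite algebra
  is a finitely supported family indexed by pairs of monomials.\<close>

type_synonym 'n nc_poly = "'n list \<Rightarrow>\<^sub>0 complex"
type_synonym 'n nc_bipoly = "('n list \<times> 'n list) \<Rightarrow>\<^sub>0 complex"

definition word_eval :: "('n \<Rightarrow> 'h::chilbert_space op) \<Rightarrow> 'n list \<Rightarrow> 'h op" where
  "word_eval X w = foldr (\<lambda>j a. X j o\<^sub>L a) w id_blinfun"

definition poly_eval :: "('n \<Rightarrow> 'h::chilbert_space op) \<Rightarrow> 'n nc_poly \<Rightarrow> 'h op" where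
  "poly_eval X p = (\<Sum>w\<in>Poly_Mapping.keys p. scale_op (Poly_Mapping.lookup p w) (word_eval X w))"

definition free_diff_quotient :: "'n \<Rightarrow> 'n nc_poly \<Rightarrow> 'n nc_bipoly" where
  "free_diff_quotient j p =
     (\<Sum>w\<in>Poly_Mapping.keys p. \<Sum>i | i < length w \<and> w ! i = j.
        Poly_Mapping.single (take i w, drop (Suc i) w) (Poly_Mapping.lookup p w))"

text \<open>Elements of the algebraic tensor product of \<open>M\<close> and its opposite algebra are represented by
  formal linear combinations of pairs, \<open>(a, b)\<close> standing for the elementary tensor of \<open>a\<close> and
  \<open>b\<^sup>o\<^sup>p\<close>.  On elementary tensors \<open>(a, b)\<close> and \<open>(c, d)\<close>, the inner product of the L2-space of
  \<open>\<tau> \<otimes> \<tau>\<^sup>o\<^sup>p\<close> is \<open>\<tau>(c* a) \<tau>(b d*)\<close>, where the second factor has its order reversed by the opposite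
  multiplication.\<close>

definition bipoly_eval ::
    "('n \<Rightarrow> 'h::chilbert_space op) \<Rightarrow> 'n nc_bipoly \<Rightarrow> (('h op \<times> 'h op) \<Rightarrow>\<^sub>0 complex)" where
  "bipoly_eval X q = (\<Sum>(u, v)\<in>Poly_Mapping.keys q.
     Poly_Mapping.single (word_eval X u, word_eval X v) (Poly_Mapping.lookup q (u, v)))"

definition HS_inner ::
    "('h::chilbert_space op \<Rightarrow> complex) \<Rightarrow> (('h op \<times> 'h op) \<Rightarrow>\<^sub>0 complex) \<Rightarrow>
     (('h op \<times> 'h op) \<Rightarrow>\<^sub>0 complex) \<Rightarrow> complex" where
  "HS_inner \<tau> s t = (\<Sum>(a, b)\<in>Poly_Mapping.keys s. \<Sum>(c, d)\<in>Poly_Mapping.keys t.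
     Poly_Mapping.lookup s (a, b) * cnj (Poly_Mapping.lookup t (c, d)) *
     \<tau> (adj c o\<^sub>L a) * \<tau> (b o\<^sub>L adj d))"

section \<open>Conjugate variables and free Fisher information\<close>

definition conjugate_variables ::
    "('h::chilbert_space op \<Rightarrow> complex) \<Rightarrow> ('n::finite \<Rightarrow> 'h op) \<Rightarrow> ('n \<Rightarrow> nat \<Rightarrow> 'h op) \<Rightarrow> bool" where
  "conjugate_variables \<tau> X \<xi> \<longleftrightarrow>
     (\<forall>j. \<xi> j \<in> L2_vectors \<tau> (W_star X)) \<and>
     (\<forall>j p. L2_inner \<tau> (\<xi> j) (\<lambda>_. poly_eval X p) =
        HS_inner \<tau> (Poly_Mapping.single (id_blinfun, id_blinfun) 1)
          (bipoly_eval X (free_diff_quotient j p)))"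

text \<open>Conjugate variables are unique as vectors, since the \<open>p(X)\<close> are dense in the L2-space of
  \<open>W*(X)\<close>.  Hence the infima below are over a single value; they only discharge the choice of a
  representing Cauchy sequence.\<close>

definition free_fisher :: "('h::chilbert_space op \<Rightarrow> complex) \<Rightarrow> ('n::finite \<Rightarrow> 'h op) \<Rightarrow> ereal" where
  "free_fisher \<tau> X =
     (if \<exists>\<xi>. conjugate_variables \<tau> X \<xi>
      then INF \<xi>\<in>Collect (conjugate_variables \<tau> X). ereal (\<Sum>j\<in>UNIV. (L2_norm \<tau> (\<xi> j))\<^sup>2)
      else \<infinity>)"

definition rel_free_fisher ::
    "real \<Rightarrow> ('h::chilbert_space op \<Rightarrow> complex) \<Rightarrow> ('n::finite \<Rightarrow> 'h op) \<Rightarrow> ereal" where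
  "rel_free_fisher \<rho> \<tau> X =
     (if \<exists>\<xi>. conjugate_variables \<tau> X \<xi>
      then INF \<xi>\<in>Collect (conjugate_variables \<tau> X).
             ereal (\<Sum>j\<in>UNIV. (L2_norm \<tau> (\<lambda>k. \<xi> j k - \<rho> *\<^sub>R X j))\<^sup>2)
      else \<infinity>)"

section \<open>Freeness and semicircular tuples\<close>

text \<open>A list of pairs \<open>(i, a)\<close> encodes a product of elements \<open>a \<in> A i\<close> whose consecutive factors
  come from different members of the family.\<close>

definition freely_independent ::
    "('h::chilbert_space op \<Rightarrow> complex) \<Rightarrow> ('i \<Rightarrow> 'h op set) \<Rightarrow> bool" where
  "freely_independent \<tau> A \<longleftrightarrow>
     (\<forall>ps :: ('i \<times> 'h op) list. ps \<noteq> [] \<longrightarrow> distinct_adj (map fst ps) \<longrightarrow>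
        (\<forall>(i, a)\<in>set ps. a \<in> A i \<and> \<tau> a = 0) \<longrightarrow>
        \<tau> (foldr (o\<^sub>L) (map snd ps) id_blinfun) = 0)"

definition free_tuples ::
    "('h::chilbert_space op \<Rightarrow> complex) \<Rightarrow> ('m::finite \<Rightarrow> 'h op) \<Rightarrow> ('n::finite \<Rightarrow> 'h op) \<Rightarrow> bool" where
  "free_tuples \<tau> X Y \<longleftrightarrow> freely_independent \<tau> (case_bool (W_star X) (W_star Y))"

text \<open>The distribution of a bounded self-adjoint operator is determined by its moments; here they
  are those of the semicircle law with mean 0 and variance \<open>v\<close>.\<close>

definition semicircular :: "('h::chilbert_space op \<Rightarrow> complex) \<Rightarrow> real \<Rightarrow> 'h op \<Rightarrow> bool" where
  "semicircular \<tau> v s \<longleftrightarrow> adj s = s \<and>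
     (\<forall>k::nat. \<tau> (((o\<^sub>L) s ^^ k) id_blinfun) =
        of_real (integral {- 2 * sqrt v .. 2 * sqrt v}
          (\<lambda>x. x ^ k * (sqrt (4 * v - x\<^sup>2) / (2 * pi * v)))))"

definition free_semicircular_tuple ::
    "'h::chilbert_space op set \<Rightarrow> ('h op \<Rightarrow> complex) \<Rightarrow> real \<Rightarrow> ('n::finite \<Rightarrow> 'h op) \<Rightarrow> bool" where
  "free_semicircular_tuple M \<tau> v S \<longleftrightarrow>
     (\<forall>j. S j \<in> M \<and> semicircular \<tau> v (S j)) \<and>
     freely_independent \<tau> (\<lambda>j. vN_generated {S j})"

section \<open>Non-microstates free entropy\<close>

text \<open>The formula defining the entropy of \<open>Y\<close> through a given semicircular tuple \<open>S\<close>.  The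
  integrand is extended real valued; its integral is the difference of those of its positive and
  negative parts, the former being finite.\<close>

definition entropy_formula ::
    "('h::chilbert_space op \<Rightarrow> complex) \<Rightarrow> ('n::finite \<Rightarrow> 'h op) \<Rightarrow> ('n \<Rightarrow> 'h op) \<Rightarrow> ereal" where
  "entropy_formula \<tau> Y S =
     (let n = real CARD('n);
          f = (\<lambda>t. ereal (n / (1 + t)) - free_fisher \<tau> (\<lambda>j. Y j + sqrt t *\<^sub>R S j))
      in ereal (1/2) *
           (enn2ereal (\<integral>\<^sup>+t\<in>{0<..}. e2ennreal (f t) \<partial>lborel) -
            enn2ereal (\<integral>\<^sup>+t\<in>{0<..}. e2ennreal (- f t) \<partial>lborel)) +
         ereal (n / 2 * ln (2 * pi * exp 1)))"

text \<open>The algebra containing \<open>X\<close> need not contain a semicircular tuple free from \<open>X\<close>.  As usual,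
  it is then replaced by another tracial von Neumann algebra \<open>N\<close>, containing a tuple \<open>Y\<close> with the
  joint law of \<open>X\<close> together with a semicircular tuple \<open>S\<close> free from \<open>Y\<close>.  The formula depends on
  the law of \<open>X\<close> only, so the supremum is over a single value.

  It suffices to let \<open>N\<close> act on the same Hilbert space \<^typ>\<open>'h\<close>: if that is infinite-dimensional,
  then it carries such an \<open>N\<close>, namely an amplification of the separably acting von Neumann algebra
  of the free product.  If it is finite-dimensional, there is no such \<open>N\<close> and the supremum is
  \<open>-\<infinity>\<close>, which is the entropy in that case, since the distribution of \<open>x\<^sub>1\<close> has atoms.\<close>

definition free_entropy :: "('h::chilbert_space op \<Rightarrow> complex) \<Rightarrow> ('n::finite \<Rightarrow> 'h op) \<Rightarrow> ereal" where
  "free_entropy \<tau> X = Sup {entropy_formula \<sigma> Y S | (N :: 'h op set) \<sigma> Y S.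
     tracial_vN_algebra N \<sigma> \<and> sa_tuple N Y \<and>
     (\<forall>w. \<sigma> (word_eval Y w) = \<tau> (word_eval X w)) \<and>
     free_semicircular_tuple N \<sigma> 1 S \<and> free_tuples \<sigma> Y S}"

definition rel_free_entropy ::
    "real \<Rightarrow> ('h::chilbert_space op \<Rightarrow> complex) \<Rightarrow> ('n::finite \<Rightarrow> 'h op) \<Rightarrow> ereal" where
  "rel_free_entropy \<rho> \<tau> X =
     ereal (\<rho> / 2 * (\<Sum>j\<in>UNIV. Re (\<tau> (X j o\<^sub>L X j)))) - free_entropy \<tau> X"

text \<open>The entropy of a semicircular tuple is finite.  The entropy of \<open>X\<close> is less than \<open>\<infinity>\<close>, and it may
  be \<open>-\<infinity>\<close> only if the Fisher information of \<open>X\<close> is \<open>\<infinity>\<close>; then subtracting a multiple of the gap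
  from the relative Fisher information gives \<open>\<infinity> - \<infinity>\<close>, which is \<open>\<infinity>\<close> in \<^typ>\<open>ereal\<close>.\<close>

definition entropy_gap ::
    "real \<Rightarrow> ('h::chilbert_space op \<Rightarrow> complex) \<Rightarrow> ('n::finite \<Rightarrow> 'h op) \<Rightarrow> ('n \<Rightarrow> 'h op) \<Rightarrow> ereal" where
  "entropy_gap \<rho> \<tau> X Z = rel_free_entropy \<rho> \<tau> X - rel_free_entropy \<rho> \<tau> Z"

text \<open>The function \<open>t - log (1 + t)\<close>, with its limit as value at \<open>\<infinity>\<close>.  It is used for \<open>t > -1\<close>
  only.\<close>

definition d_fun :: "ereal \<Rightarrow> ereal" where
  "d_fun t = (case t of ereal r \<Rightarrow> ereal (r - ln (1 + r)) | _ \<Rightarrow> \<infinity>)"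

end

theory Submission
  imports Defs "HOL-Real_Asymp.Real_Asymp"
begin

text \<open>Expanding \<open>\<Phi>*(X | V\<^sub>\<rho>)\<close> by means of \<open>\<langle>\<xi>\<^sub>j, x\<^sub>j\<rangle> = 1\<close> and cancelling the second moments, the claim becomes
  the conjunction of \<open>\<chi>*(X) \<ge> n/2 log (2\<pi>e n / \<Phi>*(X))\<close> and \<open>\<chi>*(\<rho>\<^sup>-\<^sup>1\<^sup>/\<^sup>2 S) \<le> n/2 log (2\<pi>e / \<rho>)\<close>.
  The latter follows from the Cauchy-Schwarz bound \<open>1 \<le> \<parallel>\<xi>\<^sub>j\<parallel>\<^sup>2 \<tau>(x\<^sub>j\<^sup>2)\<close> along the semicircular flow, the
  former from the free Stam inequality \<open>\<Phi>*(X + \<surd>t S) \<le> r\<^sup>2 \<Phi>*(X) + (1 - r)\<^sup>2 n / t\<close> at the optimal \<open>r\<close>.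
  Stam's inequality holds because the projection of \<open>r \<xi>\<^sub>j + (1 - r) s\<^sub>j / \<surd>t\<close> to \<open>L\<^sup>2(W*(X + \<surd>t S))\<close> is a
  conjugate variable, which in turn rests on freeness: \<open>\<xi>\<^sub>j\<close> and \<open>s\<^sub>j\<close> remain conjugate variables for
  \<open>x\<^sub>j\<close> and \<open>s\<^sub>j\<close> in the joint algebra of \<open>X\<close> and \<open>S\<close>.\<close>

section \<open>Positive semidefinite forms\<close>

text \<open>Both entropy bounds compare Fisher information with a profile n / (a + t), that of a
  free semicircular tuple of variance a + t, and the integral of n / (1 + t) - n / (a + t) is n log
  a. Cauchy-Schwarz gives a = 1 / \<rho>, Stam's inequality a = n / F, where F is the Fisher
  information of X. Inserting both leaves F - n \<rho> - n \<rho> log (F / (n \<rho>)), which is n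
  \<rho> times d at F / (n \<rho>) - 1. The obstacle is that a conjugate variable is tested only on
  words in X, whereas Stam's inequality needs mixed words in X and S, and freeness speaks only of
  alternating products of centred elements. Centring and merging turn letters into operators that
  are no longer words, so a derivative has to travel with each operator. This is what
  \<open>'h factor\<close> stores, without reference to polynomials. Conditional expectations are
  not constructed either: a Riesz argument on Cauchy sequences gives the projections.\<close>

lemma discriminant_le:
  fixes p q b :: real
  assumes nonneg: "\<And>r. 0 \<le> p - 2 * r * b + r\<^sup>2 * q" and "0 \<le> q"
  shows "b\<^sup>2 \<le> p * q"
proof (cases "q = 0")
  case True
  have "b = 0"
  proof (rule ccontr)
    assume "b \<noteq> 0"
    \<comment> \<open>With q = 0, the value at this r is p - (p + 1) = -1.\<close>
    then have "2 * ((p + 1) / (2 * b)) * b = p + 1" by simp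
    with nonneg[of "(p + 1) / (2 * b)"] True show False by simp
  qed
  with True show ?thesis by simp
next
  case False
  with \<open>0 \<le> q\<close> have "0 < q" by simp
  with nonneg[of "b / q"] show ?thesis
    by (simp add: field_simps power2_eq_square)
qed

text \<open>Semidefinite and confined to a subspace, so that one Riesz argument serves both the
  Hilbert space, where it yields adjoints, and algebras of operators under the trace form, where it
  yields projections. \<open>ip_Cauchy\<close> sequences stand in for vectors of the
  completion.\<close>

locale psd_form =
  fixes V :: "'v::real_vector set" and ip :: "'v \<Rightarrow> 'v \<Rightarrow> real"
  assumes subspace_V: "subspace V"
    and ip_add_left: "\<lbrakk>a \<in> V; b \<in> V; c \<in> V\<rbrakk> \<Longrightarrow> ip (a + b) c = ip a c + ip b c"
    and ip_scaleR_left: "\<lbrakk>a \<in> V; b \<in> V\<rbrakk> \<Longrightarrow> ip (r *\<^sub>R a) b = r * ip a b"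
    and ip_commute: "\<lbrakk>a \<in> V; b \<in> V\<rbrakk> \<Longrightarrow> ip a b = ip b a"
    and ip_nonneg: "a \<in> V \<Longrightarrow> 0 \<le> ip a a"
begin

lemma V_closed [simp]:
  "0 \<in> V" "\<lbrakk>a \<in> V; b \<in> V\<rbrakk> \<Longrightarrow> a + b \<in> V" "a \<in> V \<Longrightarrow> r *\<^sub>R a \<in> V" "\<lbrakk>a \<in> V; b \<in> V\<rbrakk> \<Longrightarrow> a - b \<in> V"
  using subspace_V by (auto simp: subspace_0 subspace_add subspace_scale subspace_diff)

lemma ip_add_right: "\<lbrakk>a \<in> V; b \<in> V; c \<in> V\<rbrakk> \<Longrightarrow> ip c (a + b) = ip c a + ip c b"
  by (metis V_closed(2) ip_add_left ip_commute)

lemma ip_scaleR_right: "\<lbrakk>a \<in> V; b \<in> V\<rbrakk> \<Longrightarrow> ip b (r *\<^sub>R a) = r * ip b a"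
  by (metis V_closed(3) ip_scaleR_left ip_commute)

lemma ip_diff_left: "\<lbrakk>a \<in> V; b \<in> V; c \<in> V\<rbrakk> \<Longrightarrow> ip (a - b) c = ip a c - ip b c"
  by (metis V_closed(4) add_diff_cancel_right' diff_add_cancel ip_add_left)

lemma ip_diff_right: "\<lbrakk>a \<in> V; b \<in> V; c \<in> V\<rbrakk> \<Longrightarrow> ip c (a - b) = ip c a - ip c b"
  by (metis V_closed(4) ip_diff_left ip_commute)

lemmas ip_simps = ip_add_left ip_add_right ip_scaleR_left ip_scaleR_right ip_diff_left ip_diff_right

lemma ip_cauchy_schwarz:
  assumes "a \<in> V" "b \<in> V"
  shows "(ip a b)\<^sup>2 \<le> ip a a * ip b b"
proof -
  have q: "0 \<le> ip a a - 2 * r * ip a b + r\<^sup>2 * ip b b" for r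
    using ip_nonneg[of "a - r *\<^sub>R b"] assms
    by (simp add: ip_simps ip_commute[of b a] power2_eq_square algebra_simps)
  from this ip_nonneg[OF assms(2)] show ?thesis by (rule discriminant_le)
qed

lemma ip_abs_le: "\<lbrakk>a \<in> V; b \<in> V\<rbrakk> \<Longrightarrow> \<bar>ip a b\<bar> \<le> sqrt (ip a a) * sqrt (ip b b)"
  using ip_cauchy_schwarz[of a b] real_le_rsqrt[of "\<bar>ip a b\<bar>" "ip a a * ip b b"]
  by (simp add: real_sqrt_mult)

lemma sqrt_ip_triangle:
  assumes "a \<in> V" "b \<in> V"
  shows "sqrt (ip (a + b) (a + b)) \<le> sqrt (ip a a) + sqrt (ip b b)"
proof (rule real_le_lsqrt)
  show "ip (a + b) (a + b) \<le> (sqrt (ip a a) + sqrt (ip b b))\<^sup>2"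
    using ip_abs_le[OF assms] assms ip_nonneg
    by (simp add: power2_sum ip_simps ip_commute[of b a])
qed (use assms ip_nonneg in auto)

lemma sqrt_ip_diff_le:
  assumes "a \<in> V" "b \<in> V"
  shows "\<bar>sqrt (ip a a) - sqrt (ip b b)\<bar> \<le> sqrt (ip (a - b) (a - b))"
  using sqrt_ip_triangle[of "a - b" b] sqrt_ip_triangle[of "b - a" a] assms
  by (simp add: ip_simps algebra_simps)

definition ip_Cauchy :: "(nat \<Rightarrow> 'v) \<Rightarrow> bool" where
  "ip_Cauchy x \<longleftrightarrow> (\<forall>k. x k \<in> V) \<and>
     (\<forall>e>0. \<exists>N. \<forall>k\<ge>N. \<forall>l\<ge>N. sqrt (ip (x k - x l) (x k - x l)) < e)"

lemma ip_CauchyD: "ip_Cauchy x \<Longrightarrow> x k \<in> V"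
  by (simp add: ip_Cauchy_def)

lemma convergent_sqrt_ip:
  assumes "ip_Cauchy x"
  shows "convergent (\<lambda>k. sqrt (ip (x k) (x k)))"
proof -
  have "Cauchy (\<lambda>k. sqrt (ip (x k) (x k)))"
  proof (rule metric_CauchyI)
    fix e :: real assume "0 < e"
    then obtain N where "\<And>k l. \<lbrakk>k \<ge> N; l \<ge> N\<rbrakk> \<Longrightarrow> sqrt (ip (x k - x l) (x k - x l)) < e"
      using assms unfolding ip_Cauchy_def by metis
    then show "\<exists>N. \<forall>k\<ge>N. \<forall>l\<ge>N. dist (sqrt (ip (x k) (x k))) (sqrt (ip (x l) (x l))) < e"
      using sqrt_ip_diff_le[OF ip_CauchyD[OF assms] ip_CauchyD[OF assms]]
      unfolding dist_real_def by (meson le_less_trans)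
  qed
  then show ?thesis by (rule Cauchy_convergent)
qed

lemma convergent_ip:
  assumes "ip_Cauchy x" "a \<in> V"
  shows "convergent (\<lambda>k. ip (x k) a)"
proof -
  have "Cauchy (\<lambda>k. ip (x k) a)"
  proof (rule metric_CauchyI)
    fix e :: real assume "0 < e"
    \<comment> \<open>The summand 1 keeps the divisor positive when \<open>a\<close> has norm
      0.\<close>
    define s where "s = sqrt (ip a a) + 1"
    have s: "0 < s" "sqrt (ip a a) \<le> s" using ip_nonneg[OF assms(2)] by (auto simp: s_def intro: add_nonneg_pos)
    with \<open>0 < e\<close> have "0 < e / s" by simp
    then obtain N where N: "\<And>k l. \<lbrakk>k \<ge> N; l \<ge> N\<rbrakk> \<Longrightarrow> sqrt (ip (x k - x l) (x k - x l)) < e / s"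
      using assms unfolding ip_Cauchy_def by metis
    show "\<exists>N. \<forall>k\<ge>N. \<forall>l\<ge>N. dist (ip (x k) a) (ip (x l) a) < e"
    proof (intro exI allI impI)
      fix k l assume "N \<le> k" "N \<le> l"
      have "dist (ip (x k) a) (ip (x l) a) = \<bar>ip (x k - x l) a\<bar>"
        using assms by (simp add: dist_real_def ip_diff_left ip_CauchyD)
      also have "\<dots> \<le> sqrt (ip (x k - x l) (x k - x l)) * sqrt (ip a a)"
        using assms by (intro ip_abs_le) (auto simp: ip_CauchyD)
      also have "\<dots> \<le> sqrt (ip (x k - x l) (x k - x l)) * s"
        using s assms ip_nonneg[of "x k - x l"] by (intro mult_left_mono) (auto simp: ip_CauchyD)
      also have "\<dots> < e"
        using N[OF \<open>N \<le> k\<close> \<open>N \<le> l\<close>] s by (simp add: pos_less_divide_eq)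
      finally show "dist (ip (x k) a) (ip (x l) a) < e" .
    qed
  qed
  then show ?thesis by (rule Cauchy_convergent)
qed

text \<open>A minimizing sequence of \<open>ip a a - 2 * f a\<close> is Cauchy by the parallelogram law, and its limit
  in the completion represents \<open>f\<close>.\<close>

lemma riesz_sequence:
  assumes f_add: "\<And>a b. \<lbrakk>a \<in> V; b \<in> V\<rbrakk> \<Longrightarrow> f (a + b) = f a + f b"
    and f_scale: "\<And>r a. a \<in> V \<Longrightarrow> f (r *\<^sub>R a) = r * f a"
    and f_le: "\<And>a. a \<in> V \<Longrightarrow> f a \<le> C * sqrt (ip a a)"
    and "0 \<le> C"
  obtains x where "ip_Cauchy x" "\<And>a. a \<in> V \<Longrightarrow> (\<lambda>k. ip (x k) a) \<longlonglongrightarrow> f a"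
    "\<And>k. sqrt (ip (x k) (x k)) \<le> C + sqrt (1 / Suc k)"
proof -
  define J where "J a = ip a a - 2 * f a" for a
  \<comment> \<open>Completing the square: J a is at least (norm a - C)^2 - C^2.\<close>
  have J_lower: "- C\<^sup>2 \<le> J a" if "a \<in> V" for a
  proof -
    have "0 \<le> (sqrt (ip a a) - C)\<^sup>2" by simp
    with f_le[OF that] ip_nonneg[OF that] show ?thesis
      by (simp add: J_def power2_diff mult.commute)
  qed
  define m where "m = Inf (J ` V)"
  have bdd: "bdd_below (J ` V)" using J_lower by (auto intro!: bdd_belowI[of _ "- C\<^sup>2"])
  have m_le: "m \<le> J a" if "a \<in> V" for a
    unfolding m_def using bdd that by (intro cINF_lower) auto
  have "\<exists>a\<in>V. J a < m + 1 / Suc k" for k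
  proof -
    have "m < m + 1 / Suc k" by simp
    then show ?thesis unfolding m_def using bdd V_closed(1) by (subst (asm) cINF_less_iff) blast+
  qed
  then obtain x where xV: "\<And>k. x k \<in> V" and xJ: "\<And>k. J (x k) < m + 1 / Suc k" by metis
  have par: "ip (x k - x l) (x k - x l) \<le> 2 / Suc k + 2 / Suc l" for k l
  proof -
    let ?h = "(1/2) *\<^sub>R (x k + x l)"
    have "ip (x k - x l) (x k - x l) = 2 * J (x k) + 2 * J (x l) - 4 * J ?h"
      using xV by (simp add: J_def ip_simps f_add f_scale ip_commute[of "x l" "x k"] field_simps)
    with xJ[of k] xJ[of l] m_le[of ?h] xV show ?thesis by simp
  qed
  \<comment> \<open>Moving from \<open>x k\<close> along \<open>a\<close> cannot bring
    \<open>J\<close> below m, and \<open>J (x k)\<close> exceeds m by less than 1 / Suc k. Hence a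
    quadratic in r is nonnegative, and its discriminant gives the bound.\<close>
  have near: "\<bar>ip (x k) a - f a\<bar> \<le> sqrt ((1 / Suc k) * (ip a a))" if a: "a \<in> V" for a k
  proof -
    define b where "b = ip (x k) a - f a"
    have q: "0 \<le> 1 / Suc k - 2 * r * b + r\<^sup>2 * ip a a" for r
      using m_le[of "x k - r *\<^sub>R a"] xJ[of k] a xV
        f_add[of "x k - r *\<^sub>R a" "r *\<^sub>R a"]
      by (simp add: J_def b_def ip_simps f_scale ip_commute[of a "x k"] power2_eq_square algebra_simps)
    from this ip_nonneg[OF a] have "b\<^sup>2 \<le> (1 / Suc k) * ip a a" by (rule discriminant_le)
    then show ?thesis unfolding b_def[symmetric] by (metis real_sqrt_abs real_sqrt_le_iff)
  qed
  show thesis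
  proof (rule that)
    show "ip_Cauchy x" unfolding ip_Cauchy_def
    proof (intro conjI allI impI xV)
      fix e :: real assume "0 < e"
      then have "0 < e\<^sup>2 / 4" by simp
      then obtain N where "inverse (real (Suc N)) < e\<^sup>2 / 4"
        using reals_Archimedean by blast
      then have N: "1 / Suc N < e\<^sup>2 / 4" unfolding inverse_eq_divide .
      show "\<exists>N. \<forall>k\<ge>N. \<forall>l\<ge>N. sqrt (ip (x k - x l) (x k - x l)) < e"
      proof (intro exI[of _ N] allI impI)
        fix k l assume "N \<le> k" "N \<le> l"
        then have "1 / Suc k \<le> 1 / Suc N" "1 / Suc l \<le> 1 / Suc N"
          by (auto intro!: divide_left_mono)
        with N par[of k l] have "ip (x k - x l) (x k - x l) < e\<^sup>2" by simp
        with \<open>0 < e\<close> show "sqrt (ip (x k - x l) (x k - x l)) < e" by (simp add: real_less_lsqrt)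
      qed
    qed
    show "(\<lambda>k. ip (x k) a) \<longlonglongrightarrow> f a" if a: "a \<in> V" for a
    proof -
      have "(\<lambda>k. 1 / real (Suc k)) \<longlonglongrightarrow> 0" by (rule LIMSEQ_Suc[OF lim_1_over_n])
      then have "(\<lambda>k. sqrt ((1 / Suc k) * ip a a)) \<longlonglongrightarrow> sqrt (0 * ip a a)"
        by (intro tendsto_real_sqrt tendsto_mult_right)
      then have lim: "(\<lambda>k. sqrt ((1 / Suc k) * ip a a)) \<longlonglongrightarrow> 0" by simp
      have "(\<lambda>k. ip (x k) a - f a) \<longlonglongrightarrow> 0"
        by (rule Lim_null_comparison[OF _ lim]) (simp only: real_norm_def near[OF a] eventually_True)
      then show ?thesis by (simp add: LIM_zero_iff)
    qed
    \<comment> \<open>\<open>near\<close> at \<open>a = x k\<close>, divided by the norm of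
      \<open>x k\<close>. This bound later makes projections contractive.\<close>
    show "sqrt (ip (x k) (x k)) \<le> C + sqrt (1 / Suc k)" for k
    proof -
      define s where "s = sqrt (ip (x k) (x k))"
      have s: "s\<^sup>2 = ip (x k) (x k)" "0 \<le> s" using ip_nonneg[OF xV] by (auto simp: s_def)
      have "\<bar>ip (x k) (x k) - f (x k)\<bar> \<le> sqrt (1 / Suc k) * s"
        using near[OF xV, of k k] unfolding real_sqrt_mult s_def .
      with f_le[OF xV, of k] s have "s * s \<le> (C + sqrt (1 / Suc k)) * s"
        unfolding s_def[symmetric] by (auto simp: power2_eq_square algebra_simps)
      with s \<open>0 \<le> C\<close> have "s \<le> C + sqrt (1 / Suc k)"
        by (cases "s = 0") (auto simp: mult_le_cancel_right)
      then show ?thesis by (simp add: s_def)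
    qed
  qed
qed

end

section \<open>Adjoints\<close>

lemma scaleC_zero_left [simp]: "0 *\<^sub>C (x :: 'h::chilbert_space) = 0"
  using scaleC_of_real[of 0 x] by simp

lemma scaleC_one [simp]: "1 *\<^sub>C (x :: 'h::chilbert_space) = x"
  using scaleC_of_real[of 1 x] by simp

lemma cinner_add_right: "cinner (x :: 'h::chilbert_space) (y + z) = cinner x y + cinner x z"
  by (metis cinner_add_left cinner_commute complex_cnj_add)

lemma cinner_scaleC_right: "cinner (x :: 'h::chilbert_space) (c *\<^sub>C y) = cnj c * cinner x y"
  by (metis cinner_scaleC_left cinner_commute complex_cnj_mult)

lemma norm_scaleC: "norm (c *\<^sub>C x) = cmod c * norm (x :: 'h::chilbert_space)"
proof -
  have "Im (cinner x x) = 0"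
    by (metis cinner_commute complex_cnj_cancel_iff cnj.simps(2) neg_equal_zero)
  then have "cinner x x = of_real (Re (cinner x x))" by (simp add: complex_eq_iff)
  moreover have "(norm (c *\<^sub>C x))\<^sup>2 = Re (c * cnj c * cinner x x)"
    by (simp only: power2_norm_eq_inner Re_cinner[symmetric] cinner_scaleC_left cinner_scaleC_right ac_simps)
  ultimately have "(norm (c *\<^sub>C x))\<^sup>2 = (cmod c)\<^sup>2 * Re (cinner x x)"
    unfolding complex_norm_square[symmetric] by (metis Re_complex_of_real of_real_mult of_real_power)
  then have "(norm (c *\<^sub>C x))\<^sup>2 = (cmod c * norm x)\<^sup>2"
    by (simp add: Re_cinner power2_norm_eq_inner power_mult_distrib)
  then show ?thesis by (simp add: power2_eq_iff_nonneg)
qed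

lemma bounded_linear_scaleC: "bounded_linear (\<lambda>x::'h::chilbert_space. c *\<^sub>C x)"
proof (rule bounded_linear_intro[where K = "cmod c"])
  show "c *\<^sub>C (r *\<^sub>R x) = r *\<^sub>R (c *\<^sub>C x)" for r and x :: 'h
    by (simp add: scaleC_of_real[symmetric] scaleC_scaleC mult.commute)
qed (auto simp: scaleC_add_right norm_scaleC)

lemma scale_op_apply [simp]: "blinfun_apply (scale_op c a) x = c *\<^sub>C blinfun_apply a x"
  unfolding scale_op_def
  by (subst bounded_linear_Blinfun_apply)
    (auto intro: bounded_linear_compose[OF bounded_linear_scaleC] blinfun.bounded_linear_right)

lemma complex_linear_D: "complex_linear a \<Longrightarrow> blinfun_apply a (c *\<^sub>C x) = c *\<^sub>C blinfun_apply a x"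
  by (simp add: complex_linear_def)

lemma riesz_representation:
  fixes f :: "'h::chilbert_space \<Rightarrow> real"
  assumes "bounded_linear f"
  obtains z where "\<And>x. f x = inner z x"
proof -
  interpret f: bounded_linear f by fact
  interpret psd_form "UNIV :: 'h set" inner
    by unfold_locales (auto simp: inner_add_left inner_add_right inner_commute)
  obtain C where C: "\<And>x. norm (f x) \<le> norm x * C" "0 \<le> C"
    using f.nonneg_bounded by blast
  obtain x where x: "ip_Cauchy x" "\<And>a. (\<lambda>k. inner (x k) a) \<longlonglongrightarrow> f a"
  proof (rule riesz_sequence[of f C])
    show "f a \<le> C * sqrt (inner a a)" for a
      using C(1)[of a] by (simp add: norm_eq_sqrt_inner mult.commute)
  qed (auto simp: f.add f.scaleR C)
  have "Cauchy x"
    using x(1) unfolding ip_Cauchy_def Cauchy_def dist_norm norm_eq_sqrt_inner by simp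
  then obtain z where z: "x \<longlonglongrightarrow> z" by (metis Cauchy_convergent_iff convergentD)
  have "f a = inner z a" for a
    using x(2)[of a] tendsto_inner[OF z tendsto_const[of a]] LIMSEQ_unique by blast
  then show thesis by (rule that)
qed

text \<open>\<open>adj\<close> is a definite description, so existence has to come before any rule
  about it. The real Riesz theorem gives a real adjoint; complex linearity of \<open>a\<close>
  upgrades it to \<open>cinner\<close>.\<close>

lemma adjoint_exists:
  fixes a :: "'h::chilbert_space op"
  assumes "complex_linear a"
  shows "\<exists>b. \<forall>x y. cinner (blinfun_apply a x) y = cinner x (blinfun_apply b y)"
proof -
  have "\<exists>z. \<forall>x. inner (blinfun_apply a x) y = inner z x" for y
  proof -
    have "bounded_linear (\<lambda>x. inner (blinfun_apply a x) y)"
      by (rule bounded_linear_compose[OF bounded_linear_inner_left blinfun.bounded_linear_right])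
    from riesz_representation[OF this] show ?thesis by metis
  qed
  then obtain g where g: "\<And>x y. inner (blinfun_apply a x) y = inner (g y) x" by metis
  have add: "g (x + y) = g x + g y" for x y
    by (rule vector_eq_rdot[THEN iffD1]) (simp add: g[symmetric] inner_add_right inner_add_left)
  have scale: "g (r *\<^sub>R x) = r *\<^sub>R g x" for r x
    by (rule vector_eq_rdot[THEN iffD1]) (simp add: g[symmetric])
  have bound: "norm (g y) \<le> norm y * norm a" for y
  proof -
    have "norm (g y) * norm (g y) = inner (blinfun_apply a (g y)) y"
      by (simp add: g flip: power2_norm_eq_inner power2_eq_square)
    also have "\<dots> \<le> norm (blinfun_apply a (g y)) * norm y" by (rule norm_cauchy_schwarz)
    also have "\<dots> \<le> (norm a * norm (g y)) * norm y"
      by (intro mult_right_mono norm_blinfun) auto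
    finally have "norm (g y) * norm (g y) \<le> (norm y * norm a) * norm (g y)" by (simp add: ac_simps)
    then show ?thesis
      by (cases "g y = 0") (auto simp: mult_le_cancel_right)
  qed
  have "bounded_linear g" by (rule bounded_linear_intro[OF add scale bound])
  then have "blinfun_apply (Blinfun g) = g" by (rule bounded_linear_Blinfun_apply)
  moreover have "cinner (blinfun_apply a x) y = cinner x (g y)" for x y
  proof (rule complex_eqI)
    show "Re (cinner (blinfun_apply a x) y) = Re (cinner x (g y))"
      using g by (simp add: Re_cinner inner_commute[of x])
    \<comment> \<open>Multiplying the first argument by -i turns imaginary parts into real
      parts.\<close>
    have "Re (cinner (blinfun_apply a (- \<i> *\<^sub>C x)) y) = Re (cinner (- \<i> *\<^sub>C x) (g y))"
      unfolding Re_cinner g by (rule inner_commute)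
    then show "Im (cinner (blinfun_apply a x) y) = Im (cinner x (g y))"
      by (simp add: complex_linear_D[OF assms] cinner_scaleC_left)
  qed
  ultimately show ?thesis by (intro exI[of _ "Blinfun g"]) simp
qed

lemma adj_eqI:
  assumes "\<And>x y. cinner (blinfun_apply a x) y = cinner x (blinfun_apply b y)"
  shows "adj a = b"
  unfolding adj_def
proof (rule the_equality)
  fix b' assume b': "\<forall>x y. cinner (blinfun_apply a x) y = cinner x (blinfun_apply b' y)"
  show "b' = b"
  proof (rule blinfun_eqI)
    fix y
    have "inner x (blinfun_apply b' y) = inner x (blinfun_apply b y)" for x
      using b' assms by (metis Re_cinner)
    then show "blinfun_apply b' y = blinfun_apply b y" by (metis vector_eq_ldot)
  qed
qed (use assms in simp)

lemma cinner_adj: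
  assumes "complex_linear a"
  shows "cinner (blinfun_apply a x) y = cinner x (blinfun_apply (adj a) y)"
  using adjoint_exists[OF assms] adj_eqI by metis

lemma adj_id [simp]: "adj (id_blinfun :: 'h::chilbert_space op) = id_blinfun"
  by (rule adj_eqI) simp

lemma adj_add: "\<lbrakk>complex_linear a; complex_linear b\<rbrakk> \<Longrightarrow> adj (a + b) = adj a + adj b"
  by (rule adj_eqI) (simp add: blinfun.add_left cinner_add_left cinner_add_right cinner_adj)

lemma adj_scale_op: "complex_linear a \<Longrightarrow> adj (scale_op c a) = scale_op (cnj c) (adj a)"
  by (rule adj_eqI) (simp add: cinner_scaleC_left cinner_scaleC_right cinner_adj)

lemma adj_compose: "\<lbrakk>complex_linear a; complex_linear b\<rbrakk> \<Longrightarrow> adj (a o\<^sub>L b) = adj b o\<^sub>L adj a"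
  by (rule adj_eqI) (simp add: cinner_adj)

lemma adj_adj: "complex_linear a \<Longrightarrow> adj (adj a) = a"
  by (rule adj_eqI) (metis cinner_adj cinner_commute)

lemma scale_op_compose [simp]: "scale_op c a o\<^sub>L b = scale_op c (a o\<^sub>L b)"
  by (rule blinfun_eqI) simp

lemma compose_scale_op: "complex_linear b \<Longrightarrow> b o\<^sub>L scale_op c a = scale_op c (b o\<^sub>L a)"
  by (rule blinfun_eqI) (simp add: complex_linear_D)

lemma scale_op_of_real: "scale_op (of_real r) a = r *\<^sub>R a"
  by (rule blinfun_eqI) (simp add: scaleC_of_real blinfun.scaleR_left)

lemma scale_op_one [simp]: "scale_op 1 a = a"
  by (rule blinfun_eqI) simp

lemma compose_add_left: "(a + b) o\<^sub>L c = (a o\<^sub>L c) + (b o\<^sub>L c)"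
  by (rule blinfun_eqI) (simp add: blinfun.add_left)

lemma compose_add_right: "c o\<^sub>L (a + b) = (c o\<^sub>L a) + (c o\<^sub>L b)"
  by (rule blinfun_eqI) (simp add: blinfun.add_left blinfun.add_right)

lemma compose_assoc: "(a o\<^sub>L b) o\<^sub>L c = a o\<^sub>L (b o\<^sub>L c)"
  by (rule blinfun_eqI) simp

lemma compose_id [simp]: "a o\<^sub>L id_blinfun = a" "id_blinfun o\<^sub>L a = a"
  by (auto intro: blinfun_eqI)

section \<open>Operator algebras\<close>

text \<open>The closure properties shared by commutants of sets of complex linear operators, hence
  by all von Neumann algebras, and inherited by intersections of these.\<close>

definition op_algebra :: "'h::chilbert_space op set \<Rightarrow> bool" where
  "op_algebra A \<longleftrightarrow> id_blinfun \<in> A \<and> (\<forall>a\<in>A. complex_linear a) \<and>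
     (\<forall>a\<in>A. \<forall>b\<in>A. a + b \<in> A \<and> a o\<^sub>L b \<in> A) \<and> (\<forall>c. \<forall>a\<in>A. scale_op c a \<in> A)"

lemma op_algebraD:
  assumes "op_algebra A"
  shows op_algebra_id: "id_blinfun \<in> A"
    and op_algebra_linear: "a \<in> A \<Longrightarrow> complex_linear a"
    and op_algebra_add: "\<lbrakk>a \<in> A; b \<in> A\<rbrakk> \<Longrightarrow> a + b \<in> A"
    and op_algebra_compose: "\<lbrakk>a \<in> A; b \<in> A\<rbrakk> \<Longrightarrow> a o\<^sub>L b \<in> A"
    and op_algebra_scale: "a \<in> A \<Longrightarrow> scale_op c a \<in> A"
  using assms by (auto simp: op_algebra_def)

lemma op_algebra_commutant:
  assumes "\<And>a. a \<in> A \<Longrightarrow> complex_linear a"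
  shows "op_algebra (commutant A)"
  unfolding op_algebra_def
proof (intro conjI ballI allI)
  show "id_blinfun \<in> commutant A" by (simp add: commutant_def complex_linear_def)
next
  fix b assume b: "b \<in> commutant A"
  then show "complex_linear b" by (simp add: commutant_def)
  show "scale_op c b \<in> commutant A" for c
    using b assms by (auto simp: commutant_def complex_linear_def scaleC_scaleC mult.commute compose_scale_op)
  fix d assume d: "d \<in> commutant A"
  from b d show "b + d \<in> commutant A"
    by (auto simp: commutant_def complex_linear_def blinfun.add_left scaleC_add_right
        compose_add_left compose_add_right)
  from b d show "b o\<^sub>L d \<in> commutant A"
    by (auto simp: commutant_def complex_linear_def) (metis compose_assoc)
qed

lemma op_algebra_von_neumann:
  assumes "von_neumann_algebra N"
  shows "op_algebra N"
proof -
  have "op_algebra (commutant (commutant N))"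
    by (rule op_algebra_commutant) (simp add: commutant_def)
  with assms show ?thesis by (simp add: von_neumann_algebra_def)
qed

text \<open>\<open>M\<close> is one of the algebras being intersected, which bounds the intersection
  and makes its members complex linear.\<close>

lemma
  assumes "von_neumann_algebra M" "A \<subseteq> M"
  shows op_algebra_generated: "op_algebra (vN_generated A)"
    and vN_generated_subset: "vN_generated A \<subseteq> M"
  using assms op_algebra_von_neumann
  by (auto simp: vN_generated_def op_algebra_def)

lemma vN_generated_superset: "A \<subseteq> vN_generated A"
  by (auto simp: vN_generated_def)

lemma adj_in_generated: "a \<in> vN_generated A \<Longrightarrow> adj a \<in> vN_generated A"
  by (auto simp: vN_generated_def von_neumann_algebra_def)

section \<open>Derivations along products of operators\<close>

definition linear_on :: "'h::chilbert_space op set \<Rightarrow> ('h op \<Rightarrow> complex) \<Rightarrow> bool" where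
  "linear_on M \<phi> \<longleftrightarrow> (\<forall>a\<in>M. \<forall>b\<in>M. \<forall>t. \<phi> (a + scale_op t b) = \<phi> a + t * \<phi> b)"

lemma linear_onD: "\<lbrakk>linear_on M \<phi>; a \<in> M; b \<in> M\<rbrakk> \<Longrightarrow> \<phi> (a + scale_op t b) = \<phi> a + t * \<phi> b"
  by (simp add: linear_on_def)

definition bilinear_on :: "'h::chilbert_space op set \<Rightarrow> ('h op \<Rightarrow> 'h op \<Rightarrow> complex) \<Rightarrow> bool" where
  "bilinear_on M B \<longleftrightarrow> (\<forall>c\<in>M. linear_on M (B c)) \<and> (\<forall>d\<in>M. linear_on M (\<lambda>c. B c d))"

definition op_prod :: "'h::chilbert_space op list \<Rightarrow> 'h op" where
  "op_prod as = foldr (o\<^sub>L) as id_blinfun"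

lemma op_prod_simps [simp]:
  "op_prod [] = id_blinfun" "op_prod (a # as) = a o\<^sub>L op_prod as"
  by (auto simp: op_prod_def)

lemma op_prod_append [simp]: "op_prod (as @ bs) = op_prod as o\<^sub>L op_prod bs"
  by (induction as) (auto simp: compose_assoc)

lemma op_prod_in: "\<lbrakk>op_algebra A; set as \<subseteq> A\<rbrakk> \<Longrightarrow> op_prod as \<in> A"
  by (induction as) (auto intro: op_algebraD)

lemma compose_linear:
  assumes "op_algebra M" "x \<in> M"
  shows "x o\<^sub>L (a + scale_op t b) = (x o\<^sub>L a) + scale_op t (x o\<^sub>L b)"
    "(a + scale_op t b) o\<^sub>L x = (a o\<^sub>L x) + scale_op t (b o\<^sub>L x)"
  using assms by (simp_all add: compose_add_left compose_add_right compose_scale_op op_algebra_linear)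

text \<open>A factor \<open>(a, B)\<close> stands for a formal element with value \<open>a\<close> and derivative \<open>\<Sum> u \<otimes> v\<close>, where
  \<open>B c d = \<Sum> \<tau> (c u) \<tau> (v d)\<close>.  By the Leibniz rule, \<open>list_deriv c es d\<close> is the corresponding value
  for the product of the factors \<open>es\<close>.\<close>

type_synonym 'h factor = "'h op \<times> ('h op \<Rightarrow> 'h op \<Rightarrow> complex)"

fun list_deriv :: "'h::chilbert_space op \<Rightarrow> 'h factor list \<Rightarrow> 'h op \<Rightarrow> complex" where
  "list_deriv c [] d = 0"
| "list_deriv c (e # es) d =
     snd e c (op_prod (map fst es) o\<^sub>L d) + list_deriv (c o\<^sub>L fst e) es d"

definition factor_on :: "'h::chilbert_space op set \<Rightarrow> 'h factor \<Rightarrow> bool" where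
  "factor_on M e \<longleftrightarrow> fst e \<in> M \<and> bilinear_on M (snd e)"

text \<open>The Leibniz rule: the derivative of \<open>e\<close> is multiplied by the value of
  \<open>f\<close> in its right leg, that of \<open>f\<close> by the value of \<open>e\<close> in
  its left leg, and \<open>d\<close> and \<open>c\<close> absorb these multiplications.\<close>

definition factor_mult :: "'h::chilbert_space factor \<Rightarrow> 'h factor \<Rightarrow> 'h factor" where
  "factor_mult e f =
     (fst e o\<^sub>L fst f, \<lambda>c d. snd e c (fst f o\<^sub>L d) + snd f (c o\<^sub>L fst e) d)"

definition factor_add :: "'h::chilbert_space factor \<Rightarrow> complex \<Rightarrow> 'h factor \<Rightarrow> 'h factor" where
  "factor_add e t f = (fst e + scale_op t (fst f), \<lambda>c d. snd e c d + t * snd f c d)"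

text \<open>Scalars have derivative 0. Taking \<open>t\<close> to be minus the trace centres a
  factor without touching its derivative.\<close>

definition factor_shift :: "'h::chilbert_space factor \<Rightarrow> complex \<Rightarrow> 'h factor" where
  "factor_shift e t = (fst e + scale_op t id_blinfun, snd e)"

lemma list_deriv_append:
  "list_deriv c (es @ fs) d =
     list_deriv c es (op_prod (map fst fs) o\<^sub>L d) + list_deriv (c o\<^sub>L op_prod (map fst es)) fs d"
  by (induction es arbitrary: c) (auto simp: compose_assoc)

lemma list_deriv_mult:
  "list_deriv c (es @ factor_mult e f # fs) d = list_deriv c (es @ e # f # fs) d"
  by (simp add: list_deriv_append factor_mult_def compose_assoc)

lemma factor_on_prod: "\<lbrakk>op_algebra M; \<forall>e\<in>set es. factor_on M e\<rbrakk> \<Longrightarrow> op_prod (map fst es) \<in> M"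
  by (intro op_prod_in) (auto simp: factor_on_def)

lemma bilinear_on_list_deriv:
  assumes "op_algebra M" "\<forall>e\<in>set es. factor_on M e"
  shows "bilinear_on M (\<lambda>c d. list_deriv c es d)"
  using assms(2)
proof (induction es)
  case Nil
  then show ?case by (simp add: bilinear_on_def linear_on_def)
next
  case (Cons e es)
  then have "op_prod (map fst es) \<in> M" "fst e \<in> M" "bilinear_on M (snd e)"
    using factor_on_prod[OF assms(1)] by (auto simp: factor_on_def)
  with Cons show ?case
    using assms(1)
    by (auto simp: bilinear_on_def linear_on_def compose_linear[OF assms(1)] op_algebraD algebra_simps)
qed

lemma list_deriv_add:
  assumes M: "op_algebra M" and "factor_on M e" "factor_on M f"
    and es: "\<forall>e\<in>set es. factor_on M e" and fs: "\<forall>e\<in>set fs. factor_on M e"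
    and "c \<in> M" "d \<in> M"
  shows "list_deriv c (es @ factor_add e t f # fs) d =
    list_deriv c (es @ e # fs) d + t * list_deriv c (es @ f # fs) d"
proof -
  have "bilinear_on M (\<lambda>c d. list_deriv c es d)" "bilinear_on M (\<lambda>c d. list_deriv c fs d)"
    using assms by (auto intro: bilinear_on_list_deriv)
  moreover have "op_prod (map fst es) \<in> M" "op_prod (map fst fs) \<in> M"
    using assms factor_on_prod by auto
  ultimately show ?thesis
    using assms
    by (simp add: list_deriv_append factor_add_def bilinear_on_def linear_on_def
      factor_on_def compose_linear[OF M] op_algebraD compose_assoc algebra_simps)
qed

lemma op_prod_add:
  assumes M: "op_algebra M" and "factor_on M e" "factor_on M f"
    and es: "\<forall>e\<in>set es. factor_on M e" and fs: "\<forall>e\<in>set fs. factor_on M e"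
  shows "op_prod (map fst (es @ factor_add e t f # fs)) =
    op_prod (map fst (es @ e # fs)) + scale_op t (op_prod (map fst (es @ f # fs)))"
  using assms factor_on_prod[OF M es] factor_on_prod[OF M fs]
  by (simp add: factor_add_def factor_on_def compose_linear[OF M])

text \<open>When \<psi> is the pairing of an operator with a vector \<xi>, this is the equation of a
  conjugate variable, tested on a product of factors. Starting from \<open>id_blinfun\<close> on
  both sides makes the legs plain traces.\<close>

definition follows_deriv :: "('h::chilbert_space op \<Rightarrow> complex) \<Rightarrow> 'h factor list \<Rightarrow> bool" where
  "follows_deriv \<psi> es \<longleftrightarrow> \<psi> (op_prod (map fst es)) = list_deriv id_blinfun es id_blinfun"

lemma follows_deriv_mult:
  "follows_deriv \<psi> (es @ factor_mult e f # fs) \<longleftrightarrow> follows_deriv \<psi> (es @ e # f # fs)"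
  unfolding follows_deriv_def list_deriv_mult by (simp add: factor_mult_def compose_assoc)

lemma follows_deriv_add:
  assumes M: "op_algebra M" and \<psi>: "linear_on M \<psi>" and ef: "factor_on M e" "factor_on M f"
    and es: "\<forall>e\<in>set es. factor_on M e" and fs: "\<forall>e\<in>set fs. factor_on M e"
    and "follows_deriv \<psi> (es @ e # fs)" "follows_deriv \<psi> (es @ f # fs)"
  shows "follows_deriv \<psi> (es @ factor_add e t f # fs)"
proof -
  have "op_prod (map fst (es @ e # fs)) \<in> M" "op_prod (map fst (es @ f # fs)) \<in> M"
    using ef es fs by (intro factor_on_prod[OF M]; auto)+
  then show ?thesis
    using assms(7,8) linear_onD[OF \<psi>]
    unfolding follows_deriv_def op_prod_add[OF M ef es fs]
      list_deriv_add[OF M ef es fs op_algebra_id[OF M] op_algebra_id[OF M]] by simp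
qed

text \<open>A shift adds \<open>t\<close> times the identity carrying derivative 0, and a list with
  that factor inserted says the same as the list without it.\<close>

lemma follows_deriv_shift:
  assumes M: "op_algebra M" and \<psi>: "linear_on M \<psi>" and e: "factor_on M e"
    and es: "\<forall>e\<in>set es. factor_on M e" and fs: "\<forall>e\<in>set fs. factor_on M e"
    and "follows_deriv \<psi> (es @ e # fs)" "follows_deriv \<psi> (es @ fs)"
  shows "follows_deriv \<psi> (es @ factor_shift e t # fs)"
proof -
  let ?u = "(id_blinfun, \<lambda>_ _. 0)"
  have "factor_shift e t = factor_add e t ?u"
    by (simp add: factor_shift_def factor_add_def)
  moreover have "follows_deriv \<psi> (es @ ?u # fs)"
    using assms(7) by (simp add: follows_deriv_def list_deriv_append)
  moreover have "factor_on M ?u"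
    using op_algebra_id[OF M] by (simp add: factor_on_def bilinear_on_def linear_on_def)
  ultimately show ?thesis
    using assms by (simp add: follows_deriv_add)
qed

inductive_set factor_closure :: "'h::chilbert_space factor set \<Rightarrow> 'h factor set" for G where
  factor_closure_base: "e \<in> G \<Longrightarrow> e \<in> factor_closure G"
| factor_closure_mult: "\<lbrakk>e \<in> factor_closure G; f \<in> factor_closure G\<rbrakk> \<Longrightarrow> factor_mult e f \<in> factor_closure G"
| factor_closure_shift: "e \<in> factor_closure G \<Longrightarrow> factor_shift e t \<in> factor_closure G"

lemma factor_on_mult:
  "\<lbrakk>op_algebra M; factor_on M e; factor_on M f\<rbrakk> \<Longrightarrow> factor_on M (factor_mult e f)"
  by (auto simp: factor_on_def factor_mult_def bilinear_on_def linear_on_def compose_linear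
      op_algebraD algebra_simps)

lemma factor_on_shift: "\<lbrakk>op_algebra M; factor_on M e\<rbrakk> \<Longrightarrow> factor_on M (factor_shift e t)"
  by (auto simp: factor_on_def factor_shift_def op_algebraD)

lemma factor_on_closure:
  assumes "op_algebra M" "\<And>e. e \<in> G \<Longrightarrow> factor_on M e" "e \<in> factor_closure G"
  shows "factor_on M e"
  using assms(3) by induction (auto simp: assms factor_on_mult factor_on_shift)

lemma follows_deriv_closure:
  assumes M: "op_algebra M" and \<psi>: "linear_on M \<psi>" and G: "\<And>e. e \<in> G \<Longrightarrow> factor_on M e"
    and base: "\<And>es. set es \<subseteq> G \<Longrightarrow> follows_deriv \<psi> es"
    and "set fs \<subseteq> factor_closure G"
  shows "follows_deriv \<psi> fs"
proof -
  \<comment> \<open>The suffix \<open>fs\<close> is already treated behind every prefix from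
    \<open>G\<close>, so for a product \<open>f\<close> is settled before \<open>e\<close>.\<close>
  have step: "follows_deriv \<psi> (es @ e # fs)"
    if "e \<in> factor_closure G" "set es \<subseteq> G" "\<And>es. set es \<subseteq> G \<Longrightarrow> follows_deriv \<psi> (es @ fs)"
      "set fs \<subseteq> factor_closure G" for e es fs
    using that
  proof (induction arbitrary: es fs)
    case (factor_closure_base e)
    from factor_closure_base(3)[of "es @ [e]"] factor_closure_base show ?case by simp
  next
    case (factor_closure_mult e f)
    then show ?case by (simp add: follows_deriv_mult)
  next
    case (factor_closure_shift e t)
    then show ?case
      by (intro follows_deriv_shift[OF M \<psi>]) (auto intro: factor_on_closure[OF M G] G)
  qed
  have "follows_deriv \<psi> (es @ fs)" if "set es \<subseteq> G" for es
    using assms(5) that by (induction fs arbitrary: es) (auto intro: base step)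
  from this[of "[]"] show ?thesis by simp
qed

section \<open>Freeness\<close>

locale trace_functional =
  fixes M :: "'h::chilbert_space op set" and \<tau> :: "'h op \<Rightarrow> complex"
  assumes algebra_M: "op_algebra M"
    and trace_add: "\<lbrakk>a \<in> M; b \<in> M\<rbrakk> \<Longrightarrow> \<tau> (a + b) = \<tau> a + \<tau> b"
    and trace_scale: "a \<in> M \<Longrightarrow> \<tau> (scale_op c a) = c * \<tau> a"
    and trace_id [simp]: "\<tau> id_blinfun = 1"
    and trace_commute: "\<lbrakk>a \<in> M; b \<in> M\<rbrakk> \<Longrightarrow> \<tau> (a o\<^sub>L b) = \<tau> (b o\<^sub>L a)"
begin

lemmas M_closed [simp, intro] = op_algebraD[OF algebra_M]

lemma linear_trace: "linear_on M \<tau>"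
  by (simp add: linear_on_def trace_add trace_scale)

end

text \<open>The derivative \<kappa> (1 \<otimes> 1) of a scaled generator, paired with
  \<open>c\<close> on the left and \<open>d\<close> on the right.\<close>

definition trace_tensor :: "('h::chilbert_space op \<Rightarrow> complex) \<Rightarrow> complex \<Rightarrow> 'h op \<Rightarrow> 'h op \<Rightarrow> complex" where
  "trace_tensor \<tau> \<kappa> c d = \<kappa> * \<tau> c * \<tau> d"

lemma (in trace_functional) factor_on_trace_tensor: "a \<in> M \<Longrightarrow> factor_on M (a, trace_tensor \<tau> \<kappa>)"
  by (auto simp: factor_on_def bilinear_on_def linear_on_def trace_tensor_def trace_add trace_scale algebra_simps)

lemma not_distinct_adj_split:
  assumes "\<not> distinct_adj (map fst es)"
  obtains us i e f vs where "es = us @ (i, e) # (i, f) # vs"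
proof -
  have "\<exists>us i e f vs. es = us @ (i, e) # (i, f) # vs"
    using assms
  proof (induction es)
    case (Cons x es)
    show ?case
    proof (cases "distinct_adj (map fst es)")
      case True
      with Cons.prems obtain y es' where "es = y # es'" "fst x = fst y"
        by (cases es) auto
      then show ?thesis by (metis append_Nil prod.collapse)
    next
      case False
      with Cons.IH show ?thesis by (metis append_Cons)
    qed
  qed simp
  with that show thesis by blast
qed

locale free_family = trace_functional M \<tau>
  for M :: "'h::chilbert_space op set" and \<tau> :: "'h op \<Rightarrow> complex" +
  fixes A :: "'i \<Rightarrow> 'h op set" and i0 :: 'i
  assumes free: "freely_independent \<tau> A"
    and algebra_A: "op_algebra (A i)"
    and A_subset: "A i \<subseteq> M"
begin

lemma A_in_M: "a \<in> A i \<Longrightarrow> a \<in> M"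
  using A_subset by blast

definition alternating :: "('i \<times> 'h op) list \<Rightarrow> bool" where
  "alternating ps \<longleftrightarrow> distinct_adj (map fst ps) \<and> (\<forall>(i, a)\<in>set ps. a \<in> A i \<and> \<tau> a = 0)"

lemma trace_alternating: "\<lbrakk>alternating ps; ps \<noteq> []\<rbrakk> \<Longrightarrow> \<tau> (op_prod (map snd ps)) = 0"
  using free by (auto simp: freely_independent_def alternating_def op_prod_def)

lemma alternating_in_M: "alternating ps \<Longrightarrow> op_prod (map snd ps) \<in> M"
  by (rule op_prod_in[OF algebra_M]) (auto simp: alternating_def A_in_M)

text \<open>Where there is a trace-preserving conditional expectation onto \<open>A i0\<close>, this
  is its kernel; the trace pairing describes it without constructing one.\<close>

definition orthogonal :: "'h op set" where
  "orthogonal = {c \<in> M. \<forall>a\<in>A i0. \<tau> (a o\<^sub>L c) = 0}"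

text \<open>The trace property carries a right factor round to the left, where it merges with the
  test element; a left factor merges at once.\<close>

lemma orthogonal_mult:
  assumes "c \<in> orthogonal" "a \<in> A i0"
  shows "a o\<^sub>L c \<in> orthogonal" "c o\<^sub>L a \<in> orthogonal"
proof -
  have c: "c \<in> M" "a \<in> M" "\<And>a. a \<in> A i0 \<Longrightarrow> \<tau> (a o\<^sub>L c) = 0"
    using assms A_in_M by (auto simp: orthogonal_def)
  have "\<tau> (b o\<^sub>L (a o\<^sub>L c)) = 0" "\<tau> (b o\<^sub>L (c o\<^sub>L a)) = 0" if b: "b \<in> A i0" for b
  proof -
    show "\<tau> (b o\<^sub>L (a o\<^sub>L c)) = 0"
      using c(3)[of "b o\<^sub>L a"] b assms(2) algebra_A by (simp add: op_algebraD compose_assoc)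
    have "\<tau> (b o\<^sub>L (c o\<^sub>L a)) = \<tau> ((b o\<^sub>L c) o\<^sub>L a)" by (simp add: compose_assoc)
    also have "\<dots> = \<tau> (a o\<^sub>L (b o\<^sub>L c))" using c b A_in_M by (intro trace_commute) auto
    also have "\<dots> = \<tau> ((a o\<^sub>L b) o\<^sub>L c)" by (simp add: compose_assoc)
    also have "\<dots> = 0" using c(3) b assms(2) algebra_A by (simp add: op_algebraD)
    finally show "\<tau> (b o\<^sub>L (c o\<^sub>L a)) = 0" .
  qed
  with c show "a o\<^sub>L c \<in> orthogonal" "c o\<^sub>L a \<in> orthogonal"
    by (auto simp: orthogonal_def)
qed

text \<open>Split \<open>h\<close> into its centred part and \<open>\<tau> h\<close> times the
  identity. The centred part prolongs the alternating product at the front, the scalar part leaves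
  \<open>ps\<close> itself, and both traces vanish.\<close>

lemma alternating_orthogonal_aux:
  assumes "alternating ps" "ps \<noteq> []" "fst (hd ps) \<noteq> i0" "h \<in> A i0"
  shows "\<tau> (h o\<^sub>L op_prod (map snd ps)) = 0"
proof -
  let ?p = "op_prod (map snd ps)" and ?h = "h + scale_op (- \<tau> h) id_blinfun"
  have hM: "h \<in> M" and p: "?p \<in> M" using assms by (auto simp: A_in_M alternating_in_M)
  have "?h \<in> A i0" using assms(4) algebra_A by (simp add: op_algebraD)
  moreover have "\<tau> ?h = 0" using hM by (simp add: trace_add trace_scale)
  ultimately have "alternating ((i0, ?h) # ps)"
    using assms by (cases ps) (auto simp: alternating_def)
  from trace_alternating[OF this] have "\<tau> (?h o\<^sub>L ?p) = 0" by simp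
  then have "\<tau> (h o\<^sub>L ?p) + - \<tau> h * \<tau> ?p = 0"
    using hM p by (simp only: compose_linear[OF algebra_M] linear_onD[OF linear_trace] M_closed compose_id)
  with trace_alternating assms show ?thesis by simp
qed

text \<open>A leading letter from \<open>A i0\<close> is absorbed into the test element, and what
  remains starts with another index. Only a single letter from \<open>A i0\<close> leaves nothing
  behind.\<close>

lemma alternating_orthogonal:
  assumes "alternating ps" "ps \<noteq> []" "\<And>a. ps \<noteq> [(i0, a)]"
  shows "op_prod (map snd ps) \<in> orthogonal"
proof -
  have "\<tau> (g o\<^sub>L op_prod (map snd ps)) = 0" if g: "g \<in> A i0" for g
  proof (cases "fst (hd ps) = i0")
    case False
    with assms g show ?thesis by (simp add: alternating_orthogonal_aux)
  next
    case True
    with assms obtain a ps' where ps: "ps = (i0, a) # ps'" "ps' \<noteq> []"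
      by (cases ps) auto
    with assms have "alternating ps'" "fst (hd ps') \<noteq> i0" "a \<in> A i0"
      by (cases ps'; auto simp: alternating_def)+
    with ps g alternating_orthogonal_aux[of ps' "g o\<^sub>L a"] algebra_A show ?thesis
      by (simp add: op_algebraD compose_assoc)
  qed
  with alternating_in_M[OF assms(1)] show ?thesis by (simp add: orthogonal_def)
qed

text \<open>Factors whose derivative has its legs in \<open>A i0\<close>.\<close>

definition inner_factor :: "'h factor \<Rightarrow> bool" where
  "inner_factor e \<longleftrightarrow> fst e \<in> A i0 \<and> bilinear_on M (snd e) \<and>
     (\<forall>c\<in>M. \<forall>d\<in>M. c \<in> orthogonal \<or> d \<in> orthogonal \<longrightarrow> snd e c d = 0)"

lemma inner_factor_on: "inner_factor e \<Longrightarrow> factor_on M e"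
  by (auto simp: inner_factor_def factor_on_def A_in_M)

text \<open>A Leibniz term multiplies a leg by an element of \<open>A i0\<close>, and
  \<open>orthogonal\<close> is stable under this; shifts leave the derivative alone.\<close>

lemma inner_factor_closure:
  assumes "\<And>e. e \<in> G \<Longrightarrow> inner_factor e" "e \<in> factor_closure G"
  shows "inner_factor e"
  using assms(2)
proof induction
  case (factor_closure_mult e f)
  from factor_closure_mult(3,4) have "factor_on M (factor_mult e f)"
    by (intro factor_on_mult inner_factor_on algebra_M)
  with factor_closure_mult(3,4) algebra_A[of i0] show ?case
    by (auto simp: inner_factor_def factor_on_def factor_mult_def op_algebraD orthogonal_mult A_in_M)
next
  case (factor_closure_shift e t)
  with algebra_A[of i0] show ?case
    by (auto simp: inner_factor_def factor_shift_def op_algebraD)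
qed (use assms in auto)

lemma inner_factor_trace_tensor: "a \<in> A i0 \<Longrightarrow> inner_factor (a, trace_tensor \<tau> \<kappa>)"
  using factor_on_trace_tensor[OF A_in_M] op_algebra_id[OF algebra_A[of i0]]
  by (auto simp: inner_factor_def factor_on_def orthogonal_def trace_tensor_def dest!: bspec[of _ _ id_blinfun])

text \<open>Members other than \<open>A i0\<close> act as constants, with derivative 0. Tags
  accompany the factors because one operator may lie in several members.\<close>

definition tagged_factors :: "'h factor set \<Rightarrow> 'i \<Rightarrow> 'h factor set" where
  "tagged_factors G i = (if i = i0 then factor_closure G else {(a, \<lambda>_ _. 0) | a. a \<in> A i})"

lemma tagged_factor:
  assumes G: "\<And>e. e \<in> G \<Longrightarrow> inner_factor e" and e: "e \<in> tagged_factors G i"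
  shows tagged_factor_in: "fst e \<in> A i" and tagged_factor_on: "factor_on M e"
    and tagged_factor_shift: "factor_shift e t \<in> tagged_factors G i"
    and tagged_factor_mult: "f \<in> tagged_factors G i \<Longrightarrow> factor_mult e f \<in> tagged_factors G i"
proof -
  show "fst e \<in> A i"
    using e inner_factor_closure[OF G] by (auto simp: tagged_factors_def inner_factor_def split: if_splits)
  then show "factor_on M e"
    using e inner_factor_on[OF inner_factor_closure[OF G]]
    by (auto simp: tagged_factors_def factor_on_def bilinear_on_def linear_on_def A_in_M split: if_splits)
  show "factor_shift e t \<in> tagged_factors G i"
    using e algebra_A[of i]
    by (auto simp: tagged_factors_def factor_shift_def op_algebraD split: if_splits
        intro: factor_closure_shift[unfolded factor_shift_def])
  show "factor_mult e f \<in> tagged_factors G i" if "f \<in> tagged_factors G i"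
    using e that algebra_A[of i]
    by (auto simp: tagged_factors_def factor_mult_def op_algebraD split: if_splits
        intro: factor_closure_mult[unfolded factor_mult_def])
qed

text \<open>A Leibniz term can be nonzero only at a letter tagged \<open>i0\<close>, and it pairs
  the products on the two sides of this letter. Its neighbours carry other tags, so each nonempty
  side is an alternating product in \<open>orthogonal\<close>, and one side is nonempty unless the
  letter stands alone. \<open>us\<close> is the part already passed.\<close>

lemma list_deriv_alternating:
  assumes G: "\<And>e. e \<in> G \<Longrightarrow> inner_factor e"
    and es: "\<And>i e. (i, e) \<in> set (us @ vs) \<Longrightarrow> e \<in> tagged_factors G i \<and> \<tau> (fst e) = 0"
    and dist: "distinct_adj (map fst (us @ vs))"
    and not_single: "\<And>e. us @ vs \<noteq> [(i0, e)]"
  shows "list_deriv (op_prod (map (fst \<circ> snd) us)) (map snd vs) id_blinfun = 0"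
  using es dist not_single
proof (induction vs arbitrary: us)
  case (Cons v vs)
  obtain i e where v: "v = (i, e)" by (cases v)
  let ?ps = "map (\<lambda>(i, e). (i, fst e))"
  have alt: "alternating (?ps us)" "alternating (?ps vs)"
  proof -
    have tag: "\<forall>x\<in>set (us @ v # vs). fst (snd x) \<in> A (fst x) \<and> \<tau> (fst (snd x)) = 0"
      using Cons.prems(1) tagged_factor_in[OF G] by (metis prod.collapse)
    have "distinct_adj (map fst us)" "distinct_adj (map fst vs)"
      using Cons.prems(2) by (auto simp: distinct_adj_append_iff distinct_adj_Cons)
    then show "alternating (?ps us)" "alternating (?ps vs)"
      using tag by (simp_all add: alternating_def case_prod_beta o_def)
  qed
  have us_M: "op_prod (map (fst \<circ> snd) us) \<in> M" and vs_M: "op_prod (map (fst \<circ> snd) vs) \<in> M"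
    using alternating_in_M[OF alt(1)] alternating_in_M[OF alt(2)]
    by (simp_all add: case_prod_beta o_def)
  have "snd e (op_prod (map (fst \<circ> snd) us)) (op_prod (map (fst \<circ> snd) vs)) = 0"
  proof (cases "i = i0")
    case False
    with Cons.prems(1)[of i e] v show ?thesis by (auto simp: tagged_factors_def)
  next
    case True
    with Cons.prems(1)[of i e] v have e: "inner_factor e"
      by (auto simp: tagged_factors_def intro: inner_factor_closure[OF G])
    have "op_prod (map (fst \<circ> snd) us) \<in> orthogonal \<or> op_prod (map (fst \<circ> snd) vs) \<in> orthogonal"
    proof (cases "us = []")
      case False
      have "?ps us \<noteq> [(i0, a)]" for a
        using Cons.prems(2) v True by (auto simp: distinct_adj_append_iff)
      with False alternating_orthogonal[OF alt(1)] show ?thesis by (simp add: case_prod_beta o_def)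
    next
      case us: True
      with Cons.prems(3) v True have "vs \<noteq> []" by auto
      moreover have "?ps vs \<noteq> [(i0, a)]" for a
        using Cons.prems(2) v True by (auto simp: distinct_adj_append_iff)
      ultimately show ?thesis using alternating_orthogonal[OF alt(2)] by (simp add: case_prod_beta o_def)
    qed
    with e us_M vs_M show ?thesis by (auto simp: inner_factor_def)
  qed
  moreover have "list_deriv (op_prod (map (fst \<circ> snd) (us @ [v]))) (map snd vs) id_blinfun = 0"
    using Cons.prems by (intro Cons.IH) auto
  ultimately show ?case by (simp add: v o_def)
qed simp

text \<open>Merging neighbours with equal tags and centring the factors reduces to alternating
  products of centred factors, where both sides vanish unless there is a single factor.\<close>

theorem follows_deriv_free:
  assumes \<psi>: "linear_on M \<psi>" and \<psi>_orth: "\<And>c. c \<in> orthogonal \<Longrightarrow> \<psi> c = 0"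
    and G: "\<And>e. e \<in> G \<Longrightarrow> inner_factor e"
    and base: "\<And>es. set es \<subseteq> G \<Longrightarrow> follows_deriv \<psi> es"
    and es: "\<And>i e. (i, e) \<in> set es \<Longrightarrow> e \<in> tagged_factors G i"
  shows "follows_deriv \<psi> (map snd es)"
  using es
\<comment> \<open>Merging shortens the list by one and creates at most one uncentred factor, while
  centring lowers only the second summand: the weight 2 makes both steps decrease.\<close>
proof (induction es rule: measure_induct_rule
    [where f = "\<lambda>es. 2 * length es + length (filter (\<lambda>(i, e). \<tau> (fst e) \<noteq> 0) es)"])
  case (less es)
  have on: "factor_on M e" if "(i, e) \<in> set es" for i e
    using G less.prems[OF that] by (rule tagged_factor_on)
  consider "\<not> distinct_adj (map fst es)"
    | i e where "(i, e) \<in> set es" "\<tau> (fst e) \<noteq> 0"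
    | "distinct_adj (map fst es)" "\<And>i e. (i, e) \<in> set es \<Longrightarrow> \<tau> (fst e) = 0"
    by blast
  then show ?case
  proof cases
    case 1
    then obtain us i e f vs where es: "es = us @ (i, e) # (i, f) # vs"
      by (rule not_distinct_adj_split)
    have "follows_deriv \<psi> (map snd (us @ (i, factor_mult e f) # vs))"
    proof (rule less.IH)
      fix j g assume j: "(j, g) \<in> set (us @ (i, factor_mult e f) # vs)"
      have "e \<in> tagged_factors G i" "f \<in> tagged_factors G i"
        using less.prems[of i e] less.prems[of i f] by (simp_all add: es)
      with G have "factor_mult e f \<in> tagged_factors G i" by (rule tagged_factor_mult)
      with j less.prems[of j g] show "g \<in> tagged_factors G j" by (auto simp: es)
    qed (simp add: es)
    then show ?thesis by (simp add: es follows_deriv_mult)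
  next
    case 2
    then obtain us vs where es: "es = us @ (i, e) # vs" by (meson split_list)
    let ?e = "factor_shift e (- \<tau> (fst e))"
    have "\<forall>x\<in>set (us @ vs). factor_on M (snd x)"
      using on unfolding es by (metis Un_iff list.set_intros(2) prod.collapse set_append)
    then have on_us_vs: "\<forall>f\<in>set (map snd us). factor_on M f" "\<forall>f\<in>set (map snd vs). factor_on M f"
      by auto
    have e: "e \<in> tagged_factors G i" "factor_on M e" using less.prems on 2 by auto
    have "\<tau> (fst ?e) = 0"
      using e(2) by (simp add: factor_shift_def factor_on_def trace_add trace_scale)
    then have "follows_deriv \<psi> (map snd (us @ (i, ?e) # vs))"
    proof (intro less.IH)
      fix j g assume j: "(j, g) \<in> set (us @ (i, ?e) # vs)"
      have "?e \<in> tagged_factors G i"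
        using G e(1) by (rule tagged_factor_shift)
      with j less.prems[of j g] show "g \<in> tagged_factors G j" by (auto simp: es)
    qed (use 2 in \<open>simp add: es\<close>)
    then have "follows_deriv \<psi> (map snd us @ ?e # map snd vs)" by simp
    \<comment> \<open>The scalar part of \<open>e\<close> contributes the list with \<open>e\<close>
      deleted, which is shorter.\<close>
    moreover have "follows_deriv \<psi> (map snd (us @ vs))"
      using less.prems unfolding es by (intro less.IH) (auto simp: es)
    then have "follows_deriv \<psi> (map snd us @ map snd vs)" by simp
    moreover have "factor_on M ?e" using e(2) by (rule factor_on_shift[OF algebra_M])
    ultimately have "follows_deriv \<psi> (map snd us @ factor_shift ?e (\<tau> (fst e)) # map snd vs)"
      using on_us_vs by (intro follows_deriv_shift[OF algebra_M \<psi>, of "factor_shift e (- \<tau> (fst e))"])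
    moreover have "factor_shift ?e (\<tau> (fst e)) = e"
    proof -
      have "scale_op (- t) b + scale_op t b = 0" for t and b :: "'h op"
        by (rule blinfun_eqI) (simp add: blinfun.add_left scaleC_add_left[symmetric])
      then show ?thesis by (simp add: factor_shift_def add.assoc)
    qed
    ultimately show ?thesis by (simp add: es)
  next
    case 3
    show ?thesis
    proof (cases "es = [] \<or> (\<exists>e. es = [(i0, e)])")
      case True
      then show ?thesis
        using less.prems follows_deriv_closure[OF algebra_M \<psi> inner_factor_on[OF G] base]
        by (auto simp: tagged_factors_def)
    next
      case False
      let ?ps = "map (\<lambda>(i, e). (i, fst e)) es"
      have "alternating ?ps"
        using 3 less.prems tagged_factor_in[OF G] by (auto simp: alternating_def case_prod_beta o_def)
      moreover have "?ps \<noteq> [(i0, a)]" for a using False by auto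
      ultimately have "op_prod (map snd ?ps) \<in> orthogonal"
        using False by (intro alternating_orthogonal) auto
      moreover have "list_deriv id_blinfun (map snd es) id_blinfun = 0"
        using list_deriv_alternating[OF G, of G "[]" es] 3 less.prems False by auto
      ultimately show ?thesis
        using \<psi>_orth by (simp add: follows_deriv_def case_prod_beta o_def)
    qed
  qed
qed

end

section \<open>Moments of the semicircle law\<close>

definition semicircle_moment :: "nat \<Rightarrow> real" where
  "semicircle_moment k = integral {-2..2} (\<lambda>x. x ^ k * (sqrt (4 - x\<^sup>2) / (2 * pi)))"

lemma semicircle_integrable:
  fixes p :: "real \<Rightarrow> real"
  assumes "continuous_on {-2..2} p"
  shows "(\<lambda>x. p x * (sqrt (4 - x\<^sup>2) / (2 * pi))) integrable_on {-2..2}"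
  by (rule integrable_continuous_interval) (intro continuous_intros assms; simp)

lemma abs_less_2_sqrt_pos: "\<lbrakk>-2 < x; x < 2\<rbrakk> \<Longrightarrow> 0 < 4 - x\<^sup>2" for x :: real
  using abs_square_less_1[of "x / 2"] by (simp add: power_divide)

lemma DERIV_4_minus: "((\<lambda>x. 4 - x\<^sup>2) has_real_derivative - 2 * x) (at x)"
  by (auto intro!: derivative_eq_intros)

lemma DERIV_semicircle:
  assumes "-2 < x" "x < 2"
  shows "((\<lambda>x. sqrt (4 - x\<^sup>2)) has_real_derivative - x / sqrt (4 - x\<^sup>2)) (at x)"
proof -
  from DERIV_chain2[OF DERIV_real_sqrt[OF abs_less_2_sqrt_pos[OF assms]] DERIV_4_minus] show ?thesis
    by (simp add: inverse_eq_divide)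
qed

lemma semicircle_moment_0: "semicircle_moment 0 = 1"
proof -
  define r where "r = (\<lambda>x::real. sqrt (4 - x\<^sup>2))"
  \<comment> \<open>The area under a circle of radius 2, normalized. Both \<open>r\<close> and the
    arcsine are differentiable only inside the interval, hence the interior form of the fundamental
    theorem.\<close>
  let ?F = "\<lambda>x::real. (x * r x / 2 + 2 * arcsin (x / 2)) / (2 * pi)"
  have "((\<lambda>x. x ^ 0 * (sqrt (4 - x\<^sup>2) / (2 * pi))) has_integral ?F 2 - ?F (-2)) {-2..2}"
  proof (rule fundamental_theorem_of_calculus_interior)
    fix x :: real assume "x \<in> {-2<..<2}"
    then have x: "-2 < x" "x < 2" by auto
    define s where "s = r x"
    have s: "0 < s" "s\<^sup>2 = 4 - x\<^sup>2" using abs_less_2_sqrt_pos[OF x] by (auto simp: s_def r_def)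
    have "sqrt (1 - (x / 2)\<^sup>2) = sqrt ((4 - x\<^sup>2) / 4)" by (simp add: power_divide field_simps)
    then have s2: "sqrt (1 - (x / 2)\<^sup>2) = s / 2" by (simp add: real_sqrt_divide s_def r_def)
    have "((\<lambda>x. arcsin (x / 2)) has_real_derivative inverse (s / 2) * (1 / 2)) (at x)"
      using DERIV_chain2[where f = arcsin and g = "\<lambda>x. x / 2" and x = x and s = UNIV, OF DERIV_arcsin DERIV_cdivide[OF DERIV_ident]] x
      unfolding s2 by simp
    note arcsin = this
    have r: "(r has_real_derivative - x / s) (at x)"
      using DERIV_semicircle[OF x] by (simp add: s_def r_def)
    have "(?F has_real_derivative ((s + x * (- x / s)) / 2 + 2 * ((1 / 2) / (s / 2))) / (2 * pi)) (at x)"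
      by (rule DERIV_cong, rule DERIV_cdivide[OF DERIV_add[OF DERIV_cdivide[OF DERIV_mult[OF DERIV_ident r]]
          DERIV_cmult[OF arcsin]]]) (simp add: s_def[symmetric] inverse_eq_divide)
    moreover have "(s + x * (- x / s)) / 2 + 2 * ((1 / 2) / (s / 2)) = s"
      using s by (simp add: field_simps power2_eq_square)
    ultimately show "(?F has_vector_derivative x ^ 0 * (sqrt (4 - x\<^sup>2) / (2 * pi))) (at x)"
      by (simp add: has_real_derivative_iff_has_vector_derivative s_def r_def)
  qed (auto simp: r_def intro!: continuous_intros)
  from integral_unique[OF this] have "semicircle_moment 0 = ?F 2 - ?F (-2)"
    unfolding semicircle_moment_def .
  then show ?thesis by (simp add: r_def field_simps)
qed

lemma semicircle_moment_1: "semicircle_moment 1 = 0"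
proof -
  define r where "r = (\<lambda>x::real. sqrt (4 - x\<^sup>2))"
  let ?F = "\<lambda>x::real. - ((4 - x\<^sup>2) * r x) / 3 / (2 * pi)"
  have "((\<lambda>x. x ^ 1 * (sqrt (4 - x\<^sup>2) / (2 * pi))) has_integral ?F 2 - ?F (-2)) {-2..2}"
  proof (rule fundamental_theorem_of_calculus_interior)
    fix x :: real assume "x \<in> {-2<..<2}"
    then have x: "-2 < x" "x < 2" by auto
    define s where "s = r x"
    have s: "0 < s" "s\<^sup>2 = 4 - x\<^sup>2" using abs_less_2_sqrt_pos[OF x] by (auto simp: s_def r_def)
    have r: "(r has_real_derivative - x / s) (at x)"
      using DERIV_semicircle[OF x] by (simp add: s_def r_def)
    have "(?F has_real_derivative - ((- 2 * x) * s + (4 - x\<^sup>2) * (- x / s)) / 3 / (2 * pi)) (at x)"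
      by (rule DERIV_cong, rule DERIV_cdivide[OF DERIV_cdivide[OF DERIV_minus[OF
          DERIV_mult[OF DERIV_4_minus r]]]]) (simp add: s_def[symmetric])
    moreover have "- ((- 2 * x) * s + (4 - x\<^sup>2) * (- x / s)) / 3 = x * s"
      using s unfolding s(2)[symmetric] by (simp add: field_simps power2_eq_square)
    ultimately show "(?F has_vector_derivative x ^ 1 * (sqrt (4 - x\<^sup>2) / (2 * pi))) (at x)"
      by (simp add: has_real_derivative_iff_has_vector_derivative s_def r_def)
  qed (auto simp: r_def intro!: continuous_intros)
  from integral_unique[OF this] have "semicircle_moment 1 = ?F 2 - ?F (-2)"
    unfolding semicircle_moment_def .
  then show ?thesis by simp
qed

text \<open>The function x^(k + 1) (4 - x^2)^(3/2) vanishes at both ends, and its derivative is sqrt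
  (4 - x^2) times 4 (k + 1) x^k - (k + 4) x^(k + 2).\<close>

lemma semicircle_moment_Suc_Suc:
  "real (k + 4) * semicircle_moment (k + 2) = 4 * real (k + 1) * semicircle_moment k"
proof -
  let ?w = "\<lambda>x::real. sqrt (4 - x\<^sup>2) / (2 * pi)"
  define r where "r = (\<lambda>x::real. sqrt (4 - x\<^sup>2))"
  let ?F = "\<lambda>x::real. x ^ (k + 1) * ((4 - x\<^sup>2) * r x) / (2 * pi)"
  have "((\<lambda>x. (4 * real (k + 1) * x ^ k - real (k + 4) * x ^ (k + 2)) * ?w x)
      has_integral ?F 2 - ?F (-2)) {-2..2}"
  proof (rule fundamental_theorem_of_calculus_interior)
    fix x :: real assume "x \<in> {-2<..<2}"
    then have x: "-2 < x" "x < 2" by auto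
    define s where "s = r x"
    have s: "0 < s" "s\<^sup>2 = 4 - x\<^sup>2" using abs_less_2_sqrt_pos[OF x] by (auto simp: s_def r_def)
    have r: "(r has_real_derivative - x / s) (at x)"
      using DERIV_semicircle[OF x] by (simp add: s_def r_def)
    have "(?F has_real_derivative (real (k + 1) * x ^ k * ((4 - x\<^sup>2) * s)
        + x ^ (k + 1) * ((- 2 * x) * s + (4 - x\<^sup>2) * (- x / s))) / (2 * pi)) (at x)"
      by (rule DERIV_cong, rule DERIV_cdivide[OF DERIV_mult[OF DERIV_pow
          DERIV_mult[OF DERIV_4_minus r]]]) (simp add: s_def[symmetric])
    moreover have "(4 - x\<^sup>2) * (- x / s) = - x * s"
      using s unfolding s(2)[symmetric] by (simp add: field_simps power2_eq_square)
    moreover have "real (k + 1) * x ^ k * ((4 - x\<^sup>2) * s) + x ^ (k + 1) * ((- 2 * x) * s + - x * s)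
        = (4 * real (k + 1) * x ^ k - real (k + 4) * x ^ (k + 2)) * s"
      by (simp add: algebra_simps power2_eq_square)
    ultimately show "(?F has_vector_derivative
        (4 * real (k + 1) * x ^ k - real (k + 4) * x ^ (k + 2)) * ?w x) (at x)"
      by (simp add: has_real_derivative_iff_has_vector_derivative s_def r_def)
  qed (auto simp: r_def intro!: continuous_intros)
  from integral_unique[OF this] have "integral {-2..2} (\<lambda>x. (4 * real (k + 1) * x ^ k - real (k + 4) * x ^ (k + 2)) * ?w x) = 0"
    by (simp only:) simp
  also have "(\<lambda>x. (4 * real (k + 1) * x ^ k - real (k + 4) * x ^ (k + 2)) * ?w x) =
      (\<lambda>x. 4 * real (k + 1) * (x ^ k * ?w x) - real (k + 4) * (x ^ (k + 2) * ?w x))"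
    by (rule ext) (simp only: left_diff_distrib mult.assoc)
  also have "integral {-2..2} \<dots> =
      4 * real (k + 1) * semicircle_moment k - real (k + 4) * semicircle_moment (k + 2)"
  proof -
    have "(\<lambda>x. c * (x ^ j * ?w x)) integrable_on {-2..2}" for c j
      by (intro integrable_on_mult_right semicircle_integrable continuous_intros)
    then show ?thesis
      unfolding semicircle_moment_def by (subst integral_diff) (simp_all only: integral_mult_right)
  qed
  finally show ?thesis by simp
qed

lemma fps_numeral_mult_nth: "fps_nth (numeral k * f) n = numeral k * fps_nth f n"
  by (simp only: numeral_fps_const fps_mult_left_const_nth)

text \<open>The recursion of the moments is a differential equation for their generating function \<open>M\<close>,
  which implies a homogeneous one for \<open>M - 1 - z\<^sup>2 M\<^sup>2\<close>.\<close>

lemma semicircle_ode: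
  fixes M D z :: "'a::comm_ring_1"
  assumes "2 * M + z * D = 2 + 4 * (z\<^sup>2 * (M + z * D))"
  defines "E \<equiv> D - (2 * z * M\<^sup>2 + z\<^sup>2 * (2 * M * D))"
  shows "2 * (M - 1 - z\<^sup>2 * M\<^sup>2) + z * E = 4 * (z\<^sup>2 * (z * E))" (is "?l = ?r")
proof -
  \<comment> \<open>The cofactor is the derivative of M - 1 - z^2 M^2 with respect to M.\<close>
  have "?l - ?r = (1 - 2 * z\<^sup>2 * M) * (2 * M + z * D - (2 + 4 * (z\<^sup>2 * (M + z * D))))"
    unfolding E_def by (simp add: power2_eq_square algebra_simps)
  with assms(1) show ?thesis by simp
qed

text \<open>The Catalan recursion, that is, M = 1 + z^2 M^2 read coefficientwise. Together with the
  vanishing first moment it says that a semicircular element is its own conjugate variable.\<close>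

lemma semicircle_moment_convolution:
  "semicircle_moment (k + 2) = (\<Sum>i=0..k. semicircle_moment i * semicircle_moment (k - i))"
proof -
  define M where "M = Abs_fps semicircle_moment"
  define Z where "Z = M - 1 - fps_X\<^sup>2 * M\<^sup>2"
  have ode: "2 * M + fps_X * fps_deriv M = 2 + 4 * (fps_X\<^sup>2 * (M + fps_X * fps_deriv M))"
  proof (rule fps_ext)
    fix n :: nat
    have "n = 0 \<or> n = 1 \<or> (\<exists>k. n = k + 2)" by presburger
    then consider "n = 0" | "n = 1" | k where "n = k + 2" by blast
    then show "fps_nth (2 * M + fps_X * fps_deriv M) n =
        fps_nth (2 + 4 * (fps_X\<^sup>2 * (M + fps_X * fps_deriv M))) n"
    proof cases
      case 3
      have "fps_nth (2 * M + fps_X * fps_deriv M) n = real (k + 4) * semicircle_moment (k + 2)"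
        unfolding 3 by (simp add: M_def fps_numeral_mult_nth distrib_right)
      moreover have "fps_nth (2 + 4 * (fps_X\<^sup>2 * (M + fps_X * fps_deriv M))) n =
          4 * real (k + 1) * semicircle_moment k"
        unfolding 3 by (cases k) (simp_all add: M_def fps_numeral_mult_nth fps_numeral_nth
            fps_X_power_mult_nth distrib_right)
      ultimately show ?thesis using semicircle_moment_Suc_Suc by simp
    qed (use semicircle_moment_0 semicircle_moment_1 in
        \<open>simp_all add: M_def fps_numeral_mult_nth fps_numeral_nth fps_X_power_mult_nth\<close>)
  qed
  have deriv: "fps_deriv Z = fps_deriv M - (2 * fps_X * M\<^sup>2 + fps_X\<^sup>2 * (2 * M * fps_deriv M))"
    unfolding Z_def
    by (simp only: power2_eq_square fps_deriv_mult fps_deriv_sub fps_deriv_fps_X fps_deriv_1)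
     (simp only: mult_2 mult_2_right distrib_left distrib_right mult_1_left mult_1_right diff_0_right ac_simps)
  have Z: "2 * Z + fps_X * fps_deriv Z = 4 * (fps_X\<^sup>2 * (fps_X * fps_deriv Z))"
    unfolding deriv unfolding Z_def by (rule semicircle_ode[OF ode])
  \<comment> \<open>Coefficientwise, (n + 2) Z_n = 4 (n - 2) Z_(n - 2), with right side 0 for n <
    2.\<close>
  have "fps_nth Z n = 0" for n
  proof (induction n rule: less_induct)
    case (less n)
    have "real (n + 2) * fps_nth Z n = fps_nth (2 * Z + fps_X * fps_deriv Z) n"
      by (cases n) (simp_all add: fps_numeral_mult_nth distrib_right)
    also have "\<dots> = 4 * (if n < 2 then 0 else real (n - 2) * fps_nth Z (n - 2))"
      unfolding Z fps_numeral_mult_nth fps_X_power_mult_nth by (cases "n - 2") simp_all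
    also have "\<dots> = 0" using less.IH[of "n - 2"] by simp
    finally show ?case by simp
  qed
  then have "fps_nth Z (k + 2) = 0" .
  then have "fps_nth M (k + 2) = fps_nth (M * M) k"
    unfolding Z_def by (simp add: fps_X_power_mult_nth power2_eq_square[of M])
  then show ?thesis by (simp add: M_def fps_mult_nth)
qed

section \<open>The Hilbert space of a trace\<close>

lemma adj_scaleR: "complex_linear a \<Longrightarrow> adj (r *\<^sub>R a) = r *\<^sub>R adj a"
  using adj_scale_op[of a "of_real r"] by (simp add: scale_op_of_real)

lemma subspace_op_algebra: "op_algebra A \<Longrightarrow> subspace A"
  using op_algebra_scale[of A id_blinfun 0]
  by (auto simp: subspace_def scale_op_of_real[symmetric] op_algebraD)
     (metis op_algebra_id op_algebra_scale of_real_0 scale_op_of_real scaleR_zero_left)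

locale adj_trace = trace_functional M \<tau>
  for M :: "'h::chilbert_space op set" and \<tau> :: "'h op \<Rightarrow> complex" +
  assumes adj_in_M [simp, intro]: "a \<in> M \<Longrightarrow> adj a \<in> M"
    and trace_nonneg: "a \<in> M \<Longrightarrow> 0 \<le> Re (\<tau> (adj a o\<^sub>L a))"
    and trace_real: "a \<in> M \<Longrightarrow> Im (\<tau> (adj a o\<^sub>L a)) = 0"
begin

text \<open>Polarization: the values of \<open>\<tau>\<close> at \<open>(a + 1)* (a + 1)\<close> and \<open>(\<i> a + 1)* (\<i> a + 1)\<close> are real.\<close>

lemma trace_adj: "a \<in> M \<Longrightarrow> \<tau> (adj a) = cnj (\<tau> a)"
proof -
  assume a: "a \<in> M"
  have *: "Im (\<tau> (adj b)) + Im (\<tau> b) = 0" if b: "b \<in> M" for b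
  proof -
    have "\<tau> (adj (b + id_blinfun) o\<^sub>L (b + id_blinfun)) = \<tau> (adj b o\<^sub>L b) + \<tau> (adj b) + (\<tau> b + 1)"
      using b by (simp add: adj_add compose_add_left compose_add_right trace_add add.assoc)
    then show ?thesis
      using trace_real[of "b + id_blinfun"] trace_real[OF b] b by simp
  qed
  have "Im (\<tau> (adj (scale_op \<i> a))) + Im (\<tau> (scale_op \<i> a)) = 0" using a by (intro *) simp
  with *[OF a] a show ?thesis
    by (simp add: adj_scale_op trace_scale complex_eq_iff)
qed

abbreviation ip :: "'h op \<Rightarrow> 'h op \<Rightarrow> real" where
  "ip a b \<equiv> Re (inner2 \<tau> a b)"

lemma inner2_commute: "\<lbrakk>a \<in> M; b \<in> M\<rbrakk> \<Longrightarrow> inner2 \<tau> a b = cnj (inner2 \<tau> b a)"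
  using trace_adj[of "adj a o\<^sub>L b"] by (simp add: inner2_def adj_compose adj_adj)

lemma inner2_linear_left:
  "\<lbrakk>a \<in> M; b \<in> M; c \<in> M\<rbrakk> \<Longrightarrow> inner2 \<tau> (a + scale_op t b) c = inner2 \<tau> a c + t * inner2 \<tau> b c"
  by (simp add: inner2_def compose_linear[OF algebra_M] linear_onD[OF linear_trace])

lemma inner2_linear_right:
  "\<lbrakk>a \<in> M; b \<in> M; c \<in> M\<rbrakk> \<Longrightarrow> inner2 \<tau> c (a + scale_op t b) = inner2 \<tau> c a + cnj t * inner2 \<tau> c b"
  by (subst (1 2 3) inner2_commute) (simp_all add: inner2_linear_left)

lemma inner2_scale_right: "\<lbrakk>a \<in> M; b \<in> M\<rbrakk> \<Longrightarrow> inner2 \<tau> a (scale_op t b) = cnj t * inner2 \<tau> a b"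
  by (simp add: inner2_def adj_scale_op trace_scale)

text \<open>Recovers the complex form from the real one, so that facts about \<open>ip\<close> alone
  control \<open>inner2\<close>.\<close>

lemma Im_inner2: "\<lbrakk>a \<in> M; b \<in> M\<rbrakk> \<Longrightarrow> Im (inner2 \<tau> a b) = ip a (scale_op \<i> b)"
  by (simp add: inner2_scale_right)

lemma psd_form_ip:
  assumes "subspace V" "V \<subseteq> M"
  shows "psd_form V ip"
proof
  fix a b c and r :: real
  assume "a \<in> V" "b \<in> V"
  then have ab: "a \<in> M" "b \<in> M" using assms by auto
  then show "ip (r *\<^sub>R a) b = r * ip a b"
    by (simp add: scale_op_of_real[symmetric] inner2_def compose_scale_op trace_scale)
  show "ip a b = ip b a" using inner2_commute[OF ab] by simp
  show "0 \<le> ip a a" using trace_nonneg ab by (simp add: inner2_def)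
  assume "c \<in> V"
  with ab assms show "ip (a + b) c = ip a c + ip b c"
    by (auto simp: inner2_def compose_add_right trace_add)
qed (use assms in auto)

sublocale ip: psd_form M ip
  by (rule psd_form_ip) (auto intro: subspace_op_algebra algebra_M)

lemma L2_vectors_iff:
  assumes "subspace V" "V \<subseteq> M"
  shows "\<xi> \<in> L2_vectors \<tau> V \<longleftrightarrow> psd_form.ip_Cauchy V ip \<xi>"
  unfolding psd_form.ip_Cauchy_def[OF psd_form_ip[OF assms]] L2_vectors_def norm2_def by simp

lemma L2_vectors_mono: "V \<subseteq> W \<Longrightarrow> L2_vectors \<tau> V \<subseteq> L2_vectors \<tau> W"
  by (auto simp: L2_vectors_def)

lemma L2_vectors_M: "\<xi> \<in> L2_vectors \<tau> M \<longleftrightarrow> ip.ip_Cauchy \<xi>"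
  by (rule L2_vectors_iff) (auto intro: subspace_op_algebra algebra_M)

lemma L2_norm_tendsto:
  assumes "\<xi> \<in> L2_vectors \<tau> M"
  shows "(\<lambda>k. norm2 \<tau> (\<xi> k)) \<longlonglongrightarrow> L2_norm \<tau> \<xi>"
  using ip.convergent_sqrt_ip assms
  unfolding L2_norm_def norm2_def L2_vectors_M by (simp add: convergent_LIMSEQ_iff)

lemma L2_norm_square_tendsto:
  assumes "\<xi> \<in> L2_vectors \<tau> M"
  shows "(\<lambda>k. ip (\<xi> k) (\<xi> k)) \<longlonglongrightarrow> (L2_norm \<tau> \<xi>)\<^sup>2"
proof -
  have "(norm2 \<tau> (\<xi> k))\<^sup>2 = ip (\<xi> k) (\<xi> k)" for k
    using assms ip.ip_nonneg by (simp add: norm2_def L2_vectors_M ip.ip_CauchyD)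
  with tendsto_power[OF L2_norm_tendsto[OF assms], of 2] show ?thesis by simp
qed

lemma L2_norm_nonneg: "\<xi> \<in> L2_vectors \<tau> M \<Longrightarrow> 0 \<le> L2_norm \<tau> \<xi>"
  using L2_norm_tendsto[of \<xi>] ip.ip_nonneg
  by (intro tendsto_lowerbound[OF L2_norm_tendsto])
    (auto simp: norm2_def L2_vectors_M ip.ip_CauchyD)

lemma L2_inner_tendsto:
  assumes "\<xi> \<in> L2_vectors \<tau> M" "a \<in> M"
  shows "(\<lambda>k. inner2 \<tau> (\<xi> k) a) \<longlonglongrightarrow> L2_inner \<tau> \<xi> (\<lambda>_. a)"
proof -
  have \<xi>: "ip.ip_Cauchy \<xi>" using assms by (simp add: L2_vectors_M)
  obtain x y where "(\<lambda>k. ip (\<xi> k) a) \<longlonglongrightarrow> x" "(\<lambda>k. ip (\<xi> k) (scale_op \<i> a)) \<longlonglongrightarrow> y"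
    using ip.convergent_ip[OF \<xi>] assms(2) unfolding convergent_def by blast
  then have "(\<lambda>k. inner2 \<tau> (\<xi> k) a) \<longlonglongrightarrow> Complex x y"
    using assms ip.ip_CauchyD[OF \<xi>] by (subst tendsto_complex_iff) (simp add: Im_inner2)
  then show ?thesis unfolding L2_inner_def by (metis limI)
qed

lemma const_L2_vectors [simp]: "a \<in> A \<Longrightarrow> (\<lambda>_. a) \<in> L2_vectors \<tau> A"
  using ip.ip_scaleR_left[of 0 0 0]
  by (simp add: L2_vectors_def norm2_def)

lemma L2_inner_const: "L2_inner \<tau> (\<lambda>_. a) (\<lambda>_. b) = inner2 \<tau> a b"
  by (simp add: L2_inner_def)

text \<open>\<open>inner2\<close> is antilinear in its second argument; the conjugate makes this a
  linear functional, fit for \<open>follows_deriv\<close>.\<close>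

lemma linear_on_L2_inner:
  assumes "\<xi> \<in> L2_vectors \<tau> M"
  shows "linear_on M (\<lambda>a. cnj (L2_inner \<tau> \<xi> (\<lambda>_. a)))"
  unfolding linear_on_def
proof (intro ballI allI)
  fix a b t assume ab: "a \<in> M" "b \<in> M"
  have \<xi>: "\<xi> k \<in> M" for k using assms by (simp add: L2_vectors_M ip.ip_CauchyD)
  have "(\<lambda>k. inner2 \<tau> (\<xi> k) (a + scale_op t b)) \<longlonglongrightarrow>
      L2_inner \<tau> \<xi> (\<lambda>_. a) + cnj t * L2_inner \<tau> \<xi> (\<lambda>_. b)"
    unfolding inner2_linear_right[OF ab \<xi>]
    using assms ab by (intro tendsto_intros L2_inner_tendsto)
  with L2_inner_tendsto[OF assms] ab
  have "L2_inner \<tau> \<xi> (\<lambda>_. a + scale_op t b) = L2_inner \<tau> \<xi> (\<lambda>_. a) + cnj t * L2_inner \<tau> \<xi> (\<lambda>_. b)"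
    by (intro LIMSEQ_unique) auto
  then show "cnj (L2_inner \<tau> \<xi> (\<lambda>_. a + scale_op t b)) =
      cnj (L2_inner \<tau> \<xi> (\<lambda>_. a)) + t * cnj (L2_inner \<tau> \<xi> (\<lambda>_. b))" by simp
qed

text \<open>Serves two vectors: the one in Stam's inequality, with \<open>s\<close> a semicircular,
  and \<xi> - \<rho> x in the relative Fisher information, with \<open>r = 1\<close> and
  \<open>q = - \<rho>\<close>.\<close>

lemma L2_lincomb:
  fixes r q :: real
  assumes \<xi>: "\<xi> \<in> L2_vectors \<tau> M" and s: "s \<in> M"
  defines "\<zeta> \<equiv> \<lambda>k. r *\<^sub>R \<xi> k + q *\<^sub>R s"
  shows L2_lincomb_in: "\<zeta> \<in> L2_vectors \<tau> M"
    and L2_inner_lincomb: "a \<in> M \<Longrightarrow>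
      L2_inner \<tau> \<zeta> (\<lambda>_. a) = of_real r * L2_inner \<tau> \<xi> (\<lambda>_. a) + of_real q * inner2 \<tau> s a"
    and L2_norm_lincomb:
      "(L2_norm \<tau> \<zeta>)\<^sup>2 = r\<^sup>2 * (L2_norm \<tau> \<xi>)\<^sup>2 + 2 * r * q * Re (L2_inner \<tau> \<xi> (\<lambda>_. s)) + q\<^sup>2 * ip s s"
proof -
  have \<xi>M: "\<xi> k \<in> M" for k using \<xi> by (simp add: L2_vectors_M ip.ip_CauchyD)
  have diff: "sqrt (ip (\<zeta> k - \<zeta> l) (\<zeta> k - \<zeta> l)) = \<bar>r\<bar> * sqrt (ip (\<xi> k - \<xi> l) (\<xi> k - \<xi> l))" for k l
  proof -
    have "\<zeta> k - \<zeta> l = r *\<^sub>R (\<xi> k - \<xi> l)" by (simp add: \<zeta>_def scaleR_diff_right)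
    moreover have "ip (r *\<^sub>R d) (r *\<^sub>R d) = r\<^sup>2 * ip d d" if "d \<in> M" for d
      using that by (simp add: ip.ip_scaleR_left ip.ip_scaleR_right power2_eq_square)
    ultimately show ?thesis using \<xi>M by (simp add: real_sqrt_mult)
  qed
  have "ip.ip_Cauchy \<zeta>"
    unfolding ip.ip_Cauchy_def diff
  proof (intro conjI allI impI)
    show "\<zeta> k \<in> M" for k using \<xi>M s by (simp add: \<zeta>_def)
    fix e :: real assume "0 < e"
    then have "0 < e / (\<bar>r\<bar> + 1)" by (simp add: add_nonneg_pos)
    then obtain N where N: "\<And>k l. \<lbrakk>N \<le> k; N \<le> l\<rbrakk> \<Longrightarrow> sqrt (ip (\<xi> k - \<xi> l) (\<xi> k - \<xi> l)) < e / (\<bar>r\<bar> + 1)"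
      using \<xi> unfolding L2_vectors_M ip.ip_Cauchy_def by metis
    have "\<bar>r\<bar> * sqrt (ip (\<xi> k - \<xi> l) (\<xi> k - \<xi> l)) < e" if "N \<le> k" "N \<le> l" for k l
    proof -
      have "\<bar>r\<bar> * sqrt (ip (\<xi> k - \<xi> l) (\<xi> k - \<xi> l)) \<le> (\<bar>r\<bar> + 1) * sqrt (ip (\<xi> k - \<xi> l) (\<xi> k - \<xi> l))"
        using ip.ip_nonneg \<xi>M by (intro mult_right_mono) auto
      also have "\<dots> < e" using N[OF that] by (simp add: field_simps add_nonneg_pos)
      finally show ?thesis .
    qed
    then show "\<exists>N. \<forall>k\<ge>N. \<forall>l\<ge>N. \<bar>r\<bar> * sqrt (ip (\<xi> k - \<xi> l) (\<xi> k - \<xi> l)) < e" by blast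
  qed
  then show \<zeta>: "\<zeta> \<in> L2_vectors \<tau> M" by (simp add: L2_vectors_M)
  show "L2_inner \<tau> \<zeta> (\<lambda>_. a) = of_real r * L2_inner \<tau> \<xi> (\<lambda>_. a) + of_real q * inner2 \<tau> s a"
    if a: "a \<in> M"
  proof (rule LIMSEQ_unique[OF L2_inner_tendsto[OF \<zeta> a]])
    have "inner2 \<tau> (\<zeta> k) a = of_real r * inner2 \<tau> (\<xi> k) a + of_real q * inner2 \<tau> s a" for k
      using \<xi>M s a unfolding \<zeta>_def inner2_def scale_op_of_real[symmetric]
      by (simp add: compose_add_right compose_scale_op trace_add trace_scale)
    then show "(\<lambda>k. inner2 \<tau> (\<zeta> k) a) \<longlonglongrightarrow> of_real r * L2_inner \<tau> \<xi> (\<lambda>_. a) + of_real q * inner2 \<tau> s a"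
      using a by (simp add: tendsto_intros L2_inner_tendsto[OF \<xi>])
  qed
  show "(L2_norm \<tau> \<zeta>)\<^sup>2 = r\<^sup>2 * (L2_norm \<tau> \<xi>)\<^sup>2 + 2 * r * q * Re (L2_inner \<tau> \<xi> (\<lambda>_. s)) + q\<^sup>2 * ip s s"
  proof (rule LIMSEQ_unique[OF L2_norm_square_tendsto[OF \<zeta>]])
    have "ip (\<zeta> k) (\<zeta> k) = r\<^sup>2 * ip (\<xi> k) (\<xi> k) + 2 * r * q * ip (\<xi> k) s + q\<^sup>2 * ip s s" for k
      using \<xi>M s unfolding \<zeta>_def
      by (simp add: ip.ip_simps ip.ip_commute[of s "\<xi> k"] power2_eq_square algebra_simps)
    then show "(\<lambda>k. ip (\<zeta> k) (\<zeta> k)) \<longlonglongrightarrow>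
        r\<^sup>2 * (L2_norm \<tau> \<xi>)\<^sup>2 + 2 * r * q * Re (L2_inner \<tau> \<xi> (\<lambda>_. s)) + q\<^sup>2 * ip s s"
      using s by (simp add: tendsto_intros L2_inner_tendsto[OF \<xi>] L2_norm_square_tendsto[OF \<xi>])
  qed
qed

lemma L2_cauchy_schwarz:
  assumes "\<xi> \<in> L2_vectors \<tau> M" "a \<in> M"
  shows "(Re (L2_inner \<tau> \<xi> (\<lambda>_. a)))\<^sup>2 \<le> (L2_norm \<tau> \<xi>)\<^sup>2 * ip a a"
proof (rule LIMSEQ_le)
  show "(\<lambda>k. (ip (\<xi> k) a)\<^sup>2) \<longlonglongrightarrow> (Re (L2_inner \<tau> \<xi> (\<lambda>_. a)))\<^sup>2"
    by (intro tendsto_intros L2_inner_tendsto assms)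
  show "(\<lambda>k. ip (\<xi> k) (\<xi> k) * ip a a) \<longlonglongrightarrow> (L2_norm \<tau> \<xi>)\<^sup>2 * ip a a"
    by (intro tendsto_intros L2_norm_square_tendsto assms)
  show "\<exists>N. \<forall>n\<ge>N. (ip (\<xi> n) a)\<^sup>2 \<le> ip (\<xi> n) (\<xi> n) * ip a a"
    using assms by (auto simp: L2_vectors_M intro!: ip.ip_cauchy_schwarz ip.ip_CauchyD)
qed

text \<open>\<eta> is the orthogonal projection of \<zeta> to the closure of \<open>A\<close>: the
  functional of \<zeta> on \<open>A\<close> is represented by a Cauchy sequence from
  \<open>A\<close>, and Cauchy-Schwarz bounds this functional by the norm of \<zeta>.\<close>

lemma L2_projection:
  assumes \<zeta>: "\<zeta> \<in> L2_vectors \<tau> M" and A: "op_algebra A" "A \<subseteq> M"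
  obtains \<eta> where "\<eta> \<in> L2_vectors \<tau> A" "L2_norm \<tau> \<eta> \<le> L2_norm \<tau> \<zeta>"
    "\<And>a. a \<in> A \<Longrightarrow> L2_inner \<tau> \<eta> (\<lambda>_. a) = L2_inner \<tau> \<zeta> (\<lambda>_. a)"
proof -
  have sub: "subspace A" using A by (intro subspace_op_algebra)
  interpret A: psd_form A ip by (rule psd_form_ip[OF sub A(2)])
  let ?f = "\<lambda>a. Re (L2_inner \<tau> \<zeta> (\<lambda>_. a))"
  have lin: "?f (a + r *\<^sub>R b) = ?f a + r * ?f b" if "a \<in> M" "b \<in> M" for a b r
    using arg_cong[OF linear_onD[OF linear_on_L2_inner[OF \<zeta>] that, of "of_real r"], of Re]
    by (simp add: scale_op_of_real)
  have f0: "?f 0 = 0" using lin[of 0 0 1] by simp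
  obtain \<eta> where \<eta>: "A.ip_Cauchy \<eta>" "\<And>a. a \<in> A \<Longrightarrow> (\<lambda>k. ip (\<eta> k) a) \<longlonglongrightarrow> ?f a"
    "\<And>k. sqrt (ip (\<eta> k) (\<eta> k)) \<le> L2_norm \<tau> \<zeta> + sqrt (1 / Suc k)"
  proof (rule A.riesz_sequence[of ?f "L2_norm \<tau> \<zeta>"])
    show "?f (a + b) = ?f a + ?f b" if "a \<in> A" "b \<in> A" for a b
      using lin[of a b 1] that A by auto
    show "?f (r *\<^sub>R a) = r * ?f a" if "a \<in> A" for a r
      using lin[of 0 a r] that A f0 by auto
    show "?f a \<le> L2_norm \<tau> \<zeta> * sqrt (ip a a)" if "a \<in> A" for a
    proof -
      have "a \<in> M" using that A by auto
      from L2_cauchy_schwarz[OF \<zeta> this] have "\<bar>?f a\<bar> \<le> sqrt ((L2_norm \<tau> \<zeta>)\<^sup>2 * ip a a)"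
        by (metis real_sqrt_abs real_sqrt_le_iff)
      also have "\<dots> = L2_norm \<tau> \<zeta> * sqrt (ip a a)"
        using L2_norm_nonneg[OF \<zeta>] by (simp add: real_sqrt_mult)
      finally show ?thesis by simp
    qed
  qed (use L2_norm_nonneg[OF \<zeta>] in blast)+
  show thesis
  proof (rule that)
    show \<eta>A: "\<eta> \<in> L2_vectors \<tau> A" using \<eta>(1) by (simp add: L2_vectors_iff[OF sub A(2)])
    then have \<eta>M: "\<eta> \<in> L2_vectors \<tau> M" using L2_vectors_mono[OF A(2)] by blast
    then have \<eta>_in: "\<eta> k \<in> M" for k by (simp add: L2_vectors_M ip.ip_CauchyD)
    show "L2_norm \<tau> \<eta> \<le> L2_norm \<tau> \<zeta>"
    proof (rule LIMSEQ_le[OF L2_norm_tendsto[OF \<eta>M]])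
      have "(\<lambda>k. L2_norm \<tau> \<zeta> + sqrt (1 / real (Suc k))) \<longlonglongrightarrow> L2_norm \<tau> \<zeta> + sqrt 0"
        by (intro tendsto_add tendsto_const tendsto_real_sqrt) (rule LIMSEQ_Suc[OF lim_1_over_n])
      then show "(\<lambda>k. L2_norm \<tau> \<zeta> + sqrt (1 / real (Suc k))) \<longlonglongrightarrow> L2_norm \<tau> \<zeta>" by simp
    qed (use \<eta>(3) in \<open>auto simp: norm2_def\<close>)
    fix a assume a: "a \<in> A"
    then have ia: "scale_op \<i> a \<in> A" and aM: "a \<in> M" using A by (auto intro: op_algebraD)
    have Re: "Re (L2_inner \<tau> \<eta> (\<lambda>_. b)) = ?f b" if "b \<in> A" for b
      using that A by (intro LIMSEQ_unique[OF tendsto_Re[OF L2_inner_tendsto[OF \<eta>M]] \<eta>(2)]) auto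
    \<comment> \<open>The Riesz construction fixes real parts only; the imaginary part at
      \<open>a\<close> is the real part at \<open>scale_op \<i> a\<close>.\<close>
    have Im: "Im (L2_inner \<tau> \<xi> (\<lambda>_. a)) = Re (L2_inner \<tau> \<xi> (\<lambda>_. scale_op \<i> a))"
      if "\<xi> \<in> L2_vectors \<tau> M" for \<xi>
      using linear_onD[OF linear_on_L2_inner[OF that], of 0 a \<i>]
        linear_onD[OF linear_on_L2_inner[OF that], of 0 0 1] aM
      by (simp add: complex_eq_iff)
    show "L2_inner \<tau> \<eta> (\<lambda>_. a) = L2_inner \<tau> \<zeta> (\<lambda>_. a)"
      by (rule complex_eqI) (simp_all add: Re a ia Im[OF \<eta>M] Im[OF \<zeta>])
  qed
qed

end

lemma adj_trace_tracial:
  assumes "tracial_vN_algebra M \<tau>"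
  shows "adj_trace M \<tau>"
proof
  have vN: "von_neumann_algebra M" using assms by (simp add: tracial_vN_algebra_def)
  then show "op_algebra M" by (rule op_algebra_von_neumann)
  show "a \<in> M \<Longrightarrow> adj a \<in> M" for a using vN by (simp add: von_neumann_algebra_def)
qed (use assms in \<open>auto simp: tracial_vN_algebra_def\<close>)

section \<open>Conjugate variables\<close>

text \<open>Linear extension of \<open>g\<close> from basis elements. It brings both sides of the
  conjugate variable equation to one form, to be compared word by word.\<close>

definition weighted_sum :: "('k \<Rightarrow> complex) \<Rightarrow> ('k \<Rightarrow>\<^sub>0 complex) \<Rightarrow> complex" where
  "weighted_sum g p = (\<Sum>k\<in>Poly_Mapping.keys p. Poly_Mapping.lookup p k * g k)"

lemma weighted_sum_superset:
  "\<lbrakk>finite K; Poly_Mapping.keys p \<subseteq> K\<rbrakk> \<Longrightarrow> weighted_sum g p = (\<Sum>k\<in>K. Poly_Mapping.lookup p k * g k)"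
  unfolding weighted_sum_def by (rule sum.mono_neutral_left) (auto simp: in_keys_iff)

lemma weighted_sum_add: "weighted_sum g (p + q) = weighted_sum g p + weighted_sum g q"
proof -
  let ?K = "Poly_Mapping.keys p \<union> Poly_Mapping.keys q"
  have "weighted_sum g r = (\<Sum>k\<in>?K. Poly_Mapping.lookup r k * g k)" if "r \<in> {p, q, p + q}" for r
    using that Poly_Mapping.keys_add[of p q] by (intro weighted_sum_superset) auto
  then show ?thesis by (simp add: lookup_add distrib_right sum.distrib)
qed

lemma weighted_sum_single [simp]: "weighted_sum g (Poly_Mapping.single k c) = c * g k"
  by (simp add: weighted_sum_def)

lemma weighted_sum_sum: "weighted_sum g (\<Sum>i\<in>I. f i) = (\<Sum>i\<in>I. weighted_sum g (f i))"
  by (induction I rule: infinite_finite_induct) (simp_all add: weighted_sum_add, simp_all add: weighted_sum_def)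

lemma word_eval_eq_op_prod: "word_eval X w = op_prod (map X w)"
  by (simp add: word_eval_def op_prod_def foldr_map o_def)

text \<open>The trace \<tau> \<otimes> \<tau> of the j-th difference quotient of the monomial
  \<open>w\<close>, evaluated at X.\<close>

definition word_deriv ::
    "('h::chilbert_space op \<Rightarrow> complex) \<Rightarrow> ('n \<Rightarrow> 'h op) \<Rightarrow> 'n \<Rightarrow> 'n list \<Rightarrow> complex" where
  "word_deriv \<tau> X j w = (\<Sum>i | i < length w \<and> w ! i = j.
     \<tau> (word_eval X (take i w)) * \<tau> (word_eval X (drop (Suc i) w)))"

text \<open>Letters carry \<kappa> (1 \<otimes> 1) or 0, so the Leibniz rule leaves the positions of
  j. The general \<open>c\<close> is for the induction, which moves each passed letter into
  it.\<close>

lemma list_deriv_word: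
  "list_deriv c (map (\<lambda>i. (X i, trace_tensor \<tau> (\<kappa> * of_bool (i = j)))) w) d =
     \<kappa> * (\<Sum>i | i < length w \<and> w ! i = j.
       \<tau> (c o\<^sub>L word_eval X (take i w)) * \<tau> (word_eval X (drop (Suc i) w) o\<^sub>L d))"
proof (induction w arbitrary: c)
  case (Cons x w)
  let ?I = "{i. i < length w \<and> w ! i = j}"
  let ?f = "\<lambda>i. \<tau> (c o\<^sub>L word_eval X (take i (x # w))) * \<tau> (word_eval X (drop (Suc i) (x # w)) o\<^sub>L d)"
  have "{i. i < length (x # w) \<and> (x # w) ! i = j} = (if x = j then {0} else {}) \<union> Suc ` ?I"
    by (auto simp: less_Suc_eq_0_disj)
  then have "sum ?f {i. i < length (x # w) \<and> (x # w) ! i = j} =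
      sum ?f (if x = j then {0} else {}) + sum ?f (Suc ` ?I)"
    by (simp only:) (rule sum.union_disjoint; auto)
  also have "sum ?f (Suc ` ?I) = (\<Sum>i\<in>?I. \<tau> ((c o\<^sub>L X x) o\<^sub>L word_eval X (take i w)) *
      \<tau> (word_eval X (drop (Suc i) w) o\<^sub>L d))"
    by (subst sum.reindex) (auto simp: word_eval_eq_op_prod compose_assoc)
  finally have sum: "sum ?f {i. i < length (x # w) \<and> (x # w) ! i = j} =
      (if x = j then \<tau> c * \<tau> (word_eval X w o\<^sub>L d) else 0) +
      (\<Sum>i\<in>?I. \<tau> ((c o\<^sub>L X x) o\<^sub>L word_eval X (take i w)) * \<tau> (word_eval X (drop (Suc i) w) o\<^sub>L d))"
    by (cases "x = j") (simp_all add: word_eval_eq_op_prod)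
  have word: "op_prod (map fst (map (\<lambda>i. (X i, trace_tensor \<tau> (\<kappa> * of_bool (i = j)))) w)) = word_eval X w"
    by (simp add: word_eval_eq_op_prod o_def)
  have "list_deriv c (map (\<lambda>i. (X i, trace_tensor \<tau> (\<kappa> * of_bool (i = j)))) (x # w)) d =
      trace_tensor \<tau> (\<kappa> * of_bool (x = j)) c (word_eval X w o\<^sub>L d) +
      \<kappa> * (\<Sum>i\<in>?I. \<tau> ((c o\<^sub>L X x) o\<^sub>L word_eval X (take i w)) * \<tau> (word_eval X (drop (Suc i) w) o\<^sub>L d))"
    by (simp only: list.map list_deriv.simps fst_conv snd_conv word Cons.IH)
  also have "trace_tensor \<tau> (\<kappa> * of_bool (x = j)) c (word_eval X w o\<^sub>L d) =
      \<kappa> * (if x = j then \<tau> c * \<tau> (word_eval X w o\<^sub>L d) else 0)"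
    by (simp add: trace_tensor_def)
  finally show ?case unfolding sum distrib_left .
qed simp

lemma follows_deriv_word:
  "follows_deriv \<psi> (map (\<lambda>i. (X i, trace_tensor \<tau> (\<kappa> * of_bool (i = j)))) w) \<longleftrightarrow>
     \<psi> (word_eval X w) = \<kappa> * word_deriv \<tau> X j w"
  by (simp add: follows_deriv_def list_deriv_word word_deriv_def word_eval_eq_op_prod o_def)

lemma word_eval_in: "\<lbrakk>op_algebra A; range X \<subseteq> A\<rbrakk> \<Longrightarrow> word_eval X w \<in> A"
  unfolding word_eval_eq_op_prod by (rule op_prod_in) auto

lemma linear_on_sum_scale:
  assumes "op_algebra A" "linear_on A \<phi>" "\<And>i. i \<in> I \<Longrightarrow> a i \<in> A"
  shows "\<phi> (\<Sum>i\<in>I. scale_op (c i) (a i)) = (\<Sum>i\<in>I. c i * \<phi> (a i))"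
proof -
  have 0: "0 \<in> A" by (rule subspace_0[OF subspace_op_algebra[OF assms(1)]])
  have \<phi>0: "\<phi> 0 = 0"
    using linear_onD[OF assms(2) 0 0, of 1] by simp
  have "(\<Sum>i\<in>I. scale_op (c i) (a i)) \<in> A \<and>
      \<phi> (\<Sum>i\<in>I. scale_op (c i) (a i)) = (\<Sum>i\<in>I. c i * \<phi> (a i))"
    using assms(3)
  proof (induction I rule: infinite_finite_induct)
    case (insert i I)
    then show ?case
      using op_algebraD[OF assms(1)] linear_onD[OF assms(2), of "\<Sum>i\<in>I. scale_op (c i) (a i)" "a i" "c i"]
      by (auto simp: add.commute)
  qed (auto simp: 0 \<phi>0)
  then show ?thesis ..
qed

lemma linear_on_poly_eval:
  assumes "op_algebra A" "linear_on A \<phi>" "range X \<subseteq> A"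
  shows "\<phi> (poly_eval X p) = weighted_sum (\<lambda>w. \<phi> (word_eval X w)) p"
  unfolding poly_eval_def weighted_sum_def
  by (rule linear_on_sum_scale[OF assms(1,2)]) (rule word_eval_in[OF assms(1,3)])

context adj_trace begin

text \<open>Different pairs of words may evaluate to the same pair of operators, so supports are not
  matched; additivity of \<open>weighted_sum\<close> absorbs the collisions. The conjugate comes
  from the second argument of the inner product.\<close>

lemma HS_inner_free_diff_quotient:
  assumes "range X \<subseteq> M"
  shows "HS_inner \<tau> (Poly_Mapping.single (id_blinfun, id_blinfun) 1)
      (bipoly_eval X (free_diff_quotient j p)) = cnj (weighted_sum (word_deriv \<tau> X j) p)"
proof -
  define g where "g = (\<lambda>(c, d). cnj (\<tau> (adj c)) * cnj (\<tau> (adj d)))"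
  have HS: "HS_inner \<tau> (Poly_Mapping.single (id_blinfun, id_blinfun) 1) t = cnj (weighted_sum g t)" for t
    by (simp add: HS_inner_def weighted_sum_def g_def case_prod_beta mult.assoc)
  have g_word: "g (word_eval X u, word_eval X v) = \<tau> (word_eval X u) * \<tau> (word_eval X v)" for u v
    using word_eval_in[OF algebra_M assms] by (simp add: g_def trace_adj)
  have "weighted_sum g (bipoly_eval X q) =
      weighted_sum (\<lambda>(u, v). \<tau> (word_eval X u) * \<tau> (word_eval X v)) q" for q
    by (simp add: bipoly_eval_def weighted_sum_sum case_prod_beta g_word) (simp add: weighted_sum_def case_prod_beta)
  also have "weighted_sum (\<lambda>(u, v). \<tau> (word_eval X u) * \<tau> (word_eval X v)) (free_diff_quotient j p) =
      weighted_sum (word_deriv \<tau> X j) p"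
    by (simp add: free_diff_quotient_def weighted_sum_sum)
      (simp add: weighted_sum_def word_deriv_def sum_distrib_left)
  finally show ?thesis by (simp add: HS)
qed

text \<open>Both sides of the equation are antilinear in the polynomial, so monomials suffice;
  conjugating gives the linear form of \<open>follows_deriv_word\<close>.\<close>

lemma conjugate_variables_iff:
  assumes "range X \<subseteq> M" "W_star X \<subseteq> M"
  shows "conjugate_variables \<tau> X \<xi> \<longleftrightarrow> (\<forall>j. \<xi> j \<in> L2_vectors \<tau> (W_star X) \<and>
     (\<forall>w. cnj (L2_inner \<tau> (\<xi> j) (\<lambda>_. word_eval X w)) = word_deriv \<tau> X j w))"
proof -
  have "(\<forall>p. L2_inner \<tau> (\<xi> j) (\<lambda>_. poly_eval X p) = cnj (weighted_sum (word_deriv \<tau> X j) p)) \<longleftrightarrow>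
      (\<forall>w. cnj (L2_inner \<tau> (\<xi> j) (\<lambda>_. word_eval X w)) = word_deriv \<tau> X j w)" (is "?P \<longleftrightarrow> ?W")
    if "\<xi> j \<in> L2_vectors \<tau> (W_star X)" for j
  proof -
    have \<xi>: "\<xi> j \<in> L2_vectors \<tau> M" using that L2_vectors_mono[OF assms(2)] by blast
    have "cnj (L2_inner \<tau> (\<xi> j) (\<lambda>_. poly_eval X p)) =
        weighted_sum (\<lambda>w. cnj (L2_inner \<tau> (\<xi> j) (\<lambda>_. word_eval X w))) p" for p
      using linear_on_poly_eval[OF algebra_M linear_on_L2_inner[OF \<xi>] assms(1)] .
    then have "?P \<longleftrightarrow> (\<forall>p. weighted_sum (\<lambda>w. cnj (L2_inner \<tau> (\<xi> j) (\<lambda>_. word_eval X w))) p =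
        weighted_sum (word_deriv \<tau> X j) p)"
      by (metis complex_cnj_cnj)
    also have "\<dots> \<longleftrightarrow> ?W"
    proof
      assume *: "\<forall>p. weighted_sum (\<lambda>w. cnj (L2_inner \<tau> (\<xi> j) (\<lambda>_. word_eval X w))) p =
        weighted_sum (word_deriv \<tau> X j) p"
      show ?W
      proof
        fix w show "cnj (L2_inner \<tau> (\<xi> j) (\<lambda>_. word_eval X w)) = word_deriv \<tau> X j w"
          using *[rule_format, of "Poly_Mapping.single w 1"] by simp
      qed
    qed (simp add: weighted_sum_def)
    finally show ?thesis .
  qed
  then show ?thesis
    unfolding conjugate_variables_def HS_inner_free_diff_quotient[OF assms(1)] by blast
qed

end

section \<open>The free Stam inequality\<close>

lemma op_prod_replicate: "op_prod (replicate k s) = ((o\<^sub>L) s ^^ k) id_blinfun"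
  by (induction k) auto

lemma semicircular_moment:
  assumes "semicircular \<tau> 1 s"
  shows "\<tau> (op_prod (replicate k s)) = of_real (semicircle_moment k)"
  using assms by (simp add: semicircular_def semicircle_moment_def op_prod_replicate)

lemma semicircular_trace:
  assumes "semicircular \<tau> 1 s"
  shows "\<tau> s = 0" "\<tau> (s o\<^sub>L s) = 1"
  using semicircular_moment[OF assms, of 1] semicircular_moment[OF assms, of 2]
    semicircle_moment_1 semicircle_moment_convolution[of 0] semicircle_moment_0
  by (simp_all add: numeral_2_eq_2)

lemma trace_tensor_0: "trace_tensor \<tau> 0 = (\<lambda>_ _. 0)"
  by (simp add: trace_tensor_def fun_eq_iff)

text \<open>Multilinearity expands a word in sums into mixed words; in the induction the prefix
  \<open>es\<close> holds the summands already chosen.\<close>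

lemma follows_deriv_sums:
  assumes M: "op_algebra M" and \<psi>: "linear_on M \<psi>"
    and E: "\<And>i. factor_on M (E i)" and F: "\<And>i. factor_on M (F i)"
    and base: "\<And>es. set es \<subseteq> range E \<union> range F \<Longrightarrow> follows_deriv \<psi> es"
  shows "follows_deriv \<psi> (map (\<lambda>i. factor_add (E i) t (F i)) w)"
proof -
  have factor: "factor_on M (factor_add (E i) t (F i))" for i
    using E[of i] F[of i] M
    by (auto simp: factor_on_def factor_add_def bilinear_on_def linear_on_def op_algebraD algebra_simps)
  have "follows_deriv \<psi> (es @ map (\<lambda>i. factor_add (E i) t (F i)) w)"
    if "set es \<subseteq> range E \<union> range F" for es
    using that
  proof (induction w arbitrary: es)
    case Nil
    then show ?case using base by simp
  next
    case (Cons x w)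
    have "\<forall>e\<in>set es. factor_on M e" using Cons.prems E F by auto
    moreover have "follows_deriv \<psi> (es @ e # map (\<lambda>i. factor_add (E i) t (F i)) w)"
      if "e = E x \<or> e = F x" for e
      using Cons.IH[of "es @ [e]"] Cons.prems that by auto
    then have "follows_deriv \<psi> (es @ E x # map (\<lambda>i. factor_add (E i) t (F i)) w)"
      "follows_deriv \<psi> (es @ F x # map (\<lambda>i. factor_add (E i) t (F i)) w)" by blast+
    ultimately show ?case
      using E F factor unfolding list.map by (intro follows_deriv_add[OF M \<psi>]) auto
  qed
  from this[of "[]"] show ?thesis by simp
qed

context adj_trace begin

lemma L2_inner_orthogonal:
  assumes "free_family M \<tau> A" "\<And>a. a \<in> A i \<Longrightarrow> adj a \<in> A i"
    and \<xi>: "\<xi> \<in> L2_vectors \<tau> (A i)" and c: "c \<in> free_family.orthogonal M \<tau> A i"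
  shows "L2_inner \<tau> \<xi> (\<lambda>_. c) = 0"
proof -
  interpret free_family M \<tau> A i by fact
  have cM: "c \<in> M" "\<And>a. a \<in> A i \<Longrightarrow> \<tau> (a o\<^sub>L c) = 0" using c by (auto simp: orthogonal_def)
  have "inner2 \<tau> (\<xi> k) c = 0" for k
  proof -
    have "\<xi> k \<in> A i" using \<xi> by (simp add: L2_vectors_def)
    then have "inner2 \<tau> c (\<xi> k) = 0" "\<xi> k \<in> M" using cM assms(2) A_in_M by (auto simp: inner2_def)
    with inner2_commute[OF _ cM(1), of "\<xi> k"] show ?thesis by simp
  qed
  then show ?thesis by (simp add: L2_inner_def)
qed

lemma L2_inner_self_adjoint_word:
  assumes "adj s = s" "s \<in> M" "range X \<subseteq> M"
  shows "cnj (L2_inner \<tau> (\<lambda>_. s) (\<lambda>_. word_eval X w)) = \<tau> (s o\<^sub>L word_eval X w)"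
  using inner2_commute[of s "word_eval X w"] word_eval_in[OF algebra_M assms(3)] assms
  by (simp add: L2_inner_const) (simp add: inner2_def)

end

section \<open>Free families, and the conjugate variables of a semicircular tuple\<close>

lemma tracial_von_neumann: "tracial_vN_algebra M \<tau> \<Longrightarrow> von_neumann_algebra M"
  by (simp add: tracial_vN_algebra_def)

lemma free_family_generated:
  assumes "tracial_vN_algebra M \<tau>" "freely_independent \<tau> (\<lambda>i. vN_generated (B i))" "\<And>i. B i \<subseteq> M"
  shows "free_family M \<tau> (\<lambda>i. vN_generated (B i))"
proof -
  interpret adj_trace M \<tau> using assms(1) by (rule adj_trace_tracial)
  show ?thesis
    using assms tracial_von_neumann[OF assms(1)]
    by unfold_locales (auto intro: op_algebra_generated vN_generated_subset[THEN subsetD])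
qed

lemma free_family_tuples:
  assumes "tracial_vN_algebra M \<tau>" "free_tuples \<tau> X Y" "range X \<subseteq> M" "range Y \<subseteq> M"
  shows "free_family M \<tau> (case_bool (W_star X) (W_star Y))"
proof -
  have eq: "case_bool (W_star X) (W_star Y) = (\<lambda>b. vN_generated (case_bool (range X) (range Y) b))"
    by (rule ext) (auto split: bool.split)
  show ?thesis
    using assms unfolding eq free_tuples_def
    by (intro free_family_generated) (auto split: bool.split)
qed

lemma free_semicircular_tupleD:
  assumes "free_semicircular_tuple M \<tau> 1 S"
  shows "S j \<in> M" "semicircular \<tau> 1 (S j)" "adj (S j) = S j" "\<tau> (S j) = 0" "\<tau> (S j o\<^sub>L S j) = 1"
proof -
  show "S j \<in> M" and semi: "semicircular \<tau> 1 (S j)"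
    using assms by (auto simp: free_semicircular_tuple_def)
  from semi show "adj (S j) = S j" by (simp add: semicircular_def)
  from semi show "\<tau> (S j) = 0" "\<tau> (S j o\<^sub>L S j) = 1" by (rule semicircular_trace)+
qed

text \<open>Splitting at each position yields the convolution of moments, which is the moment of
  order n + 1. For n = 0 the sum is empty and matches the vanishing first moment.\<close>

lemma word_deriv_replicate:
  assumes "semicircular \<tau> 1 (S j)"
  shows "word_deriv \<tau> S j (replicate n j) = \<tau> (S j o\<^sub>L word_eval S (replicate n j))"
proof -
  have word: "\<tau> (word_eval S (replicate k j)) = of_real (semicircle_moment k)" for k
    using semicircular_moment[OF assms] by (simp add: word_eval_eq_op_prod)
  have "word_deriv \<tau> S j (replicate n j) =
      (\<Sum>i<n. of_real (semicircle_moment i) * of_real (semicircle_moment (n - Suc i)))"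
    unfolding word_deriv_def by (rule sum.cong) (auto simp: word min_def)
  also have "\<dots> = of_real (semicircle_moment (Suc n))"
  proof (cases n)
    case 0
    then show ?thesis using semicircle_moment_1 by simp
  next
    case (Suc k)
    then show ?thesis
      using semicircle_moment_convolution[of k] by (simp add: lessThan_Suc_atMost atMost_atLeast0)
  qed
  also have "\<dots> = \<tau> (S j o\<^sub>L word_eval S (replicate n j))"
    using word[of "Suc n"] by (simp add: word_eval_eq_op_prod)
  finally show ?thesis .
qed

text \<open>Only \<open>S j\<close> carries a derivative; the other entries are constants. Words in
  \<open>S j\<close> alone are settled by the moment recursion, and freeness of the entries extends
  this to mixed words.\<close>

lemma semicircular_conjugate:
  assumes M: "tracial_vN_algebra M \<tau>" and S: "free_semicircular_tuple M \<tau> 1 S"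
  shows "cnj (L2_inner \<tau> (\<lambda>_. S j) (\<lambda>_. word_eval S w)) = word_deriv \<tau> S j w"
proof -
  let ?A = "\<lambda>i. vN_generated {S i}"
  let ?\<psi> = "\<lambda>a. cnj (L2_inner \<tau> (\<lambda>_. S j) (\<lambda>_. a))"
  let ?G = "{(S j, trace_tensor \<tau> 1)}"
  note SM = free_semicircular_tupleD[OF S]
  interpret adj_trace M \<tau> using M by (rule adj_trace_tracial)
  have family: "free_family M \<tau> ?A"
    using M S SM(1) by (intro free_family_generated) (auto simp: free_semicircular_tuple_def)
  then interpret free_family M \<tau> ?A j .
  have SA: "S i \<in> ?A i" for i using vN_generated_superset by blast
  have "follows_deriv ?\<psi> (map snd (map (\<lambda>i. (i, S i, trace_tensor \<tau> (1 * of_bool (i = j)))) w))"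
  proof (rule follows_deriv_free[where G = ?G])
    show "linear_on M ?\<psi>" using SM by (intro linear_on_L2_inner) simp
    show "?\<psi> c = 0" if "c \<in> orthogonal" for c
      using L2_inner_orthogonal[OF family adj_in_generated const_L2_vectors[OF SA] that] by simp
    show "inner_factor e" if "e \<in> ?G" for e
      using that SA by (auto intro: inner_factor_trace_tensor)
    show "follows_deriv ?\<psi> es" if "set es \<subseteq> ?G" for es
    proof -
      define n where "n = length es"
      have "es = map (\<lambda>i. (S i, trace_tensor \<tau> (1 * of_bool (i = j)))) (replicate n j)"
        using that by (auto simp: n_def intro!: replicate_eqI)
      moreover have "range S \<subseteq> M" using SM by auto
      then have "?\<psi> (word_eval S (replicate n j)) = 1 * word_deriv \<tau> S j (replicate n j)"
        by (simp add: word_deriv_replicate SM L2_inner_self_adjoint_word)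
      ultimately show ?thesis by (simp only: follows_deriv_word)
    qed
    show "e \<in> tagged_factors ?G i"
      if "(i, e) \<in> set (map (\<lambda>i. (i, S i, trace_tensor \<tau> (1 * of_bool (i = j)))) w)" for i e
      using that SA by (auto simp: tagged_factors_def trace_tensor_0 intro: factor_closure_base)
  qed
  then have "follows_deriv ?\<psi> (map (\<lambda>i. (S i, trace_tensor \<tau> (1 * of_bool (i = j)))) w)"
    by (simp add: o_def)
  then show ?thesis unfolding follows_deriv_word by simp
qed

context adj_trace begin

text \<open>\<open>b\<close> selects the tuple that is differentiated, so that one statement serves
  the conjugate variables of X and those of S. The other tuple enters with derivative 0.\<close>

lemma follows_deriv_free_pair:
  fixes P Q :: "'n \<Rightarrow> 'h op"
  assumes family: "free_family M \<tau> A" and adj: "\<And>a. a \<in> A b \<Longrightarrow> adj a \<in> A b"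
    and P: "range P \<subseteq> A b" and Q: "range Q \<subseteq> A (\<not> b)" and \<xi>: "\<xi> \<in> L2_vectors \<tau> (A b)"
    and word: "\<And>w. cnj (L2_inner \<tau> \<xi> (\<lambda>_. word_eval P w)) = word_deriv \<tau> P j w"
    and es: "set es \<subseteq> range (\<lambda>i. (P i, trace_tensor \<tau> (of_bool (i = j)))) \<union> range (\<lambda>i. (Q i, trace_tensor \<tau> 0))"
  shows "follows_deriv (\<lambda>a. cnj (L2_inner \<tau> \<xi> (\<lambda>_. a))) es"
proof -
  let ?\<psi> = "\<lambda>a. cnj (L2_inner \<tau> \<xi> (\<lambda>_. a))"
  let ?G = "range (\<lambda>i. (P i, trace_tensor \<tau> (1 * of_bool (i = j))))"
  interpret free_family M \<tau> A b by fact
  have \<xi>M: "\<xi> \<in> L2_vectors \<tau> M" using \<xi> L2_vectors_mono[OF A_subset] by blast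
  have tags: "\<exists>i. e \<in> tagged_factors ?G i" if "e \<in> set es" for e
  proof (cases "e \<in> ?G")
    case True
    then have "e \<in> tagged_factors ?G b" by (auto simp: tagged_factors_def intro: factor_closure_base)
    then show ?thesis ..
  next
    case False
    with that es obtain i where "e = (Q i, trace_tensor \<tau> 0)" by auto
    moreover have "Q i \<in> A (\<not> b)" using Q by auto
    ultimately have "e \<in> tagged_factors ?G (\<not> b)" by (simp add: tagged_factors_def trace_tensor_0)
    then show ?thesis ..
  qed
  \<comment> \<open>A factor may fit both tags; \<open>follows_deriv_free\<close> accepts any
    choice.\<close>
  define tag where "tag e = (SOME i. e \<in> tagged_factors ?G i)" for e
  have tag: "e \<in> tagged_factors ?G (tag e)" if "e \<in> set es" for e
    unfolding tag_def using tags[OF that] by (rule someI_ex)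
  have "follows_deriv ?\<psi> (map snd (map (\<lambda>e. (tag e, e)) es))"
  proof (rule follows_deriv_free[where G = ?G])
    show "linear_on M ?\<psi>" using \<xi>M by (rule linear_on_L2_inner)
    show "?\<psi> c = 0" if "c \<in> orthogonal" for c
      using L2_inner_orthogonal[OF family adj \<xi> that] by simp
    show "inner_factor e" if "e \<in> ?G" for e
      using that P by (auto intro: inner_factor_trace_tensor)
    show "follows_deriv ?\<psi> es" if "set es \<subseteq> ?G" for es
    proof -
      obtain w where es: "es = map (\<lambda>i. (P i, trace_tensor \<tau> (1 * of_bool (i = j)))) w"
        using \<open>set es \<subseteq> ?G\<close> ex_map_conv[of es "\<lambda>i. (P i, trace_tensor \<tau> (1 * of_bool (i = j)))"] by blast
      show ?thesis unfolding es follows_deriv_word using word[of w] by simp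
    qed
  qed (use tag in auto)
  then show ?thesis by (simp add: o_def)
qed

end

text \<open>\<open>S j\<close> alone is a centred alternating list, whose tag differs from that of
  X.\<close>

lemma free_semicircular_orthogonal:
  assumes "tracial_vN_algebra M \<tau>" "range X \<subseteq> M" "free_semicircular_tuple M \<tau> 1 S" "free_tuples \<tau> X S"
    and "a \<in> W_star X"
  shows "\<tau> (a o\<^sub>L S j) = 0"
proof -
  have SM: "range S \<subseteq> M" and S0: "\<tau> (S j) = 0"
    using free_semicircular_tupleD[OF assms(3)] by auto
  interpret free_family M \<tau> "case_bool (W_star X) (W_star S)" True
    using assms SM by (intro free_family_tuples)
  have "alternating [(False, S j)]"
    using S0 vN_generated_superset[of "range S"] by (auto simp: alternating_def)
  from alternating_orthogonal[OF this] assms(5) show ?thesis by (simp add: orthogonal_def)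
qed

text \<open>The parameter \<open>r\<close> stays free: any combination of \<open>\<xi> j\<close> and
  \<open>S j\<close> normalized as in \<zeta> projects to conjugate variables of Y, and since the
  two vectors are orthogonal their squared norms add.\<close>

theorem free_stam_inequality:
  fixes X S :: "'n::finite \<Rightarrow> 'h::chilbert_space op"
  assumes M: "tracial_vN_algebra M \<tau>" and X: "sa_tuple M X"
    and S: "free_semicircular_tuple M \<tau> 1 S" and free: "free_tuples \<tau> X S"
    and \<xi>: "conjugate_variables \<tau> X \<xi>" and t: "0 < t"
  shows "free_fisher \<tau> (\<lambda>j. X j + sqrt t *\<^sub>R S j) \<le>
    ereal (r\<^sup>2 * (\<Sum>j\<in>UNIV. (L2_norm \<tau> (\<xi> j))\<^sup>2) + (1 - r)\<^sup>2 * (real CARD('n) / t))"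
proof -
  define Y where "Y = (\<lambda>j. X j + sqrt t *\<^sub>R S j)"
  \<comment> \<open>Chosen such that \<open>r + q * sqrt t = 1\<close>.\<close>
  define q where "q = (1 - r) / sqrt t"
  let ?A = "case_bool (W_star X) (W_star S)"
  note vN = tracial_von_neumann[OF M]
  interpret adj_trace M \<tau> using M by (rule adj_trace_tracial)
  have XM: "range X \<subseteq> M" and SM: "range S \<subseteq> M"
    using X free_semicircular_tupleD[OF S] by (auto simp: sa_tuple_def)
  then have "X j \<in> M" "S j \<in> M" for j by auto
  then have YM: "range Y \<subseteq> M" by (auto simp: Y_def)
  have WM: "W_star X \<subseteq> M" "W_star S \<subseteq> M" "W_star Y \<subseteq> M"
    using XM SM YM by (auto intro: vN_generated_subset[OF vN, THEN subsetD])
  have family: "free_family M \<tau> ?A" using M free XM SM by (rule free_family_tuples)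
  have gen: "X i \<in> W_star X" "S i \<in> W_star S" for i
    by (rule vN_generated_superset[THEN subsetD]; simp)+
  have \<xi>W: "\<xi> j \<in> L2_vectors \<tau> (W_star X)"
    and \<xi>_word: "cnj (L2_inner \<tau> (\<xi> j) (\<lambda>_. word_eval X w)) = word_deriv \<tau> X j w" for j w
    using \<xi> unfolding conjugate_variables_iff[OF XM WM(1)] by auto
  have \<xi>M: "\<xi> j \<in> L2_vectors \<tau> M" for j using \<xi>W L2_vectors_mono[OF WM(1)] by blast
  have SjM: "S j \<in> M" "inner2 \<tau> (S j) (S j) = 1" for j
    using free_semicircular_tupleD[OF S] by (auto simp: inner2_def)
  note S_orthogonal = free_semicircular_orthogonal[OF M XM S free]
  have \<xi>S: "L2_inner \<tau> (\<xi> j) (\<lambda>_. S j) = 0" for j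
  proof (rule L2_inner_orthogonal[OF family, of True])
    interpret free_family M \<tau> ?A True by fact
    show "S j \<in> orthogonal"
      using SjM S_orthogonal by (simp add: orthogonal_def)
  qed (use \<xi>W in \<open>simp_all add: adj_in_generated\<close>)
  \<comment> \<open>\<open>Y i\<close> has derivative \<delta>_ij (1 \<otimes> 1) along
    \<open>X j\<close>, and \<open>sqrt t\<close> times this along \<open>S j\<close>; hence the
    factor in the second equation.\<close>
  have word_Y:
    "cnj (L2_inner \<tau> (\<xi> j) (\<lambda>_. word_eval Y w)) = word_deriv \<tau> Y j w"
    "cnj (L2_inner \<tau> (\<lambda>_. S j) (\<lambda>_. word_eval Y w)) = sqrt t * word_deriv \<tau> Y j w" for j w
  proof -
    let ?tt = "trace_tensor \<tau>"
    have on: "factor_on M (X i, ?tt \<kappa>)" "factor_on M (S i, ?tt \<kappa>)" for i \<kappa>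
      using XM SM by (auto intro!: factor_on_trace_tensor)
    have "follows_deriv (\<lambda>a. cnj (L2_inner \<tau> (\<xi> j) (\<lambda>_. a)))
        (map (\<lambda>i. factor_add (X i, ?tt (of_bool (i = j))) (sqrt t) (S i, ?tt 0)) w)"
    proof (rule follows_deriv_sums[OF algebra_M])
      show "follows_deriv (\<lambda>a. cnj (L2_inner \<tau> (\<xi> j) (\<lambda>_. a))) es"
        if "set es \<subseteq> range (\<lambda>i. (X i, ?tt (of_bool (i = j)))) \<union> range (\<lambda>i. (S i, ?tt 0))" for es
        using that gen \<xi>W \<xi>_word
        by (intro follows_deriv_free_pair[OF family, where b = True]) (auto simp: adj_in_generated)
    qed (use on \<xi>M in \<open>auto intro: linear_on_L2_inner\<close>)
    moreover have "factor_add (X i, ?tt (of_bool (i = j))) (sqrt t) (S i, ?tt 0) = (Y i, ?tt (1 * of_bool (i = j)))" for i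
      by (simp add: factor_add_def Y_def scale_op_of_real trace_tensor_0)
    ultimately have "cnj (L2_inner \<tau> (\<xi> j) (\<lambda>_. word_eval Y w)) = 1 * word_deriv \<tau> Y j w"
      by (simp only: follows_deriv_word)
    then show "cnj (L2_inner \<tau> (\<xi> j) (\<lambda>_. word_eval Y w)) = word_deriv \<tau> Y j w" by simp
    have "follows_deriv (\<lambda>a. cnj (L2_inner \<tau> (\<lambda>_. S j) (\<lambda>_. a)))
        (map (\<lambda>i. factor_add (X i, ?tt 0) (sqrt t) (S i, ?tt (of_bool (i = j)))) w)"
    proof (rule follows_deriv_sums[OF algebra_M])
      show "follows_deriv (\<lambda>a. cnj (L2_inner \<tau> (\<lambda>_. S j) (\<lambda>_. a))) es"
        if "set es \<subseteq> range (\<lambda>i. (X i, ?tt 0)) \<union> range (\<lambda>i. (S i, ?tt (of_bool (i = j))))" for es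
        using that gen semicircular_conjugate[OF M S]
        by (intro follows_deriv_free_pair[OF family, where b = False]) (auto simp: adj_in_generated)
    qed (use on SjM in \<open>auto intro!: linear_on_L2_inner\<close>)
    moreover have "factor_add (X i, ?tt 0) (sqrt t) (S i, ?tt (of_bool (i = j))) = (Y i, ?tt (of_real (sqrt t) * of_bool (i = j)))" for i
      by (simp add: factor_add_def Y_def scale_op_of_real trace_tensor_def fun_eq_iff)
    ultimately show "cnj (L2_inner \<tau> (\<lambda>_. S j) (\<lambda>_. word_eval Y w)) = sqrt t * word_deriv \<tau> Y j w"
      by (simp only: follows_deriv_word)
  qed
  define \<zeta> where "\<zeta> = (\<lambda>j k. r *\<^sub>R \<xi> j k + q *\<^sub>R S j)"
  have \<zeta>: "\<zeta> j \<in> L2_vectors \<tau> M" for j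
    unfolding \<zeta>_def using \<xi>M SjM by (intro L2_lincomb_in)
  have algY: "op_algebra (W_star Y)" using vN YM by (rule op_algebra_generated)
  have "\<exists>\<eta>. \<eta> \<in> L2_vectors \<tau> (W_star Y) \<and> L2_norm \<tau> \<eta> \<le> L2_norm \<tau> (\<zeta> j) \<and>
      (\<forall>a\<in>W_star Y. L2_inner \<tau> \<eta> (\<lambda>_. a) = L2_inner \<tau> (\<zeta> j) (\<lambda>_. a))" for j
    using L2_projection[OF \<zeta> algY WM(3)] by metis
  then obtain \<eta> where \<eta>: "\<And>j. \<eta> j \<in> L2_vectors \<tau> (W_star Y)"
    "\<And>j. L2_norm \<tau> (\<eta> j) \<le> L2_norm \<tau> (\<zeta> j)"
    "\<And>j a. a \<in> W_star Y \<Longrightarrow> L2_inner \<tau> (\<eta> j) (\<lambda>_. a) = L2_inner \<tau> (\<zeta> j) (\<lambda>_. a)" by metis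
  have "conjugate_variables \<tau> Y \<eta>"
    unfolding conjugate_variables_iff[OF YM WM(3)]
  proof (intro allI conjI)
    show "\<eta> j \<in> L2_vectors \<tau> (W_star Y)" for j by (rule \<eta>)
    fix j w
    have w: "word_eval Y w \<in> W_star Y"
      using algY vN_generated_superset by (rule word_eval_in)
    have "cnj (L2_inner \<tau> (\<eta> j) (\<lambda>_. word_eval Y w)) =
        of_real r * cnj (L2_inner \<tau> (\<xi> j) (\<lambda>_. word_eval Y w)) +
        of_real q * cnj (L2_inner \<tau> (\<lambda>_. S j) (\<lambda>_. word_eval Y w))"
      using w WM(3) by (auto simp: \<eta>(3) \<zeta>_def L2_inner_lincomb[OF \<xi>M SjM(1)] L2_inner_const)
    also have "\<dots> = of_real (r + q * sqrt t) * word_deriv \<tau> Y j w"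
      by (simp add: word_Y distrib_right)
    also have "r + q * sqrt t = 1" using t by (simp add: q_def)
    finally show "cnj (L2_inner \<tau> (\<eta> j) (\<lambda>_. word_eval Y w)) = word_deriv \<tau> Y j w" by simp
  qed
  then have "free_fisher \<tau> Y \<le> ereal (\<Sum>j\<in>UNIV. (L2_norm \<tau> (\<eta> j))\<^sup>2)"
    unfolding free_fisher_def by (auto intro: INF_lower)
  also have "(\<Sum>j\<in>UNIV. (L2_norm \<tau> (\<eta> j))\<^sup>2) \<le> (\<Sum>j\<in>UNIV. r\<^sup>2 * (L2_norm \<tau> (\<xi> j))\<^sup>2 + q\<^sup>2)"
  proof (rule sum_mono)
    fix j
    have "\<eta> j \<in> L2_vectors \<tau> M" using \<eta>(1) L2_vectors_mono[OF WM(3)] by blast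
    then have "(L2_norm \<tau> (\<eta> j))\<^sup>2 \<le> (L2_norm \<tau> (\<zeta> j))\<^sup>2"
      using \<eta>(2) by (intro power_mono L2_norm_nonneg)
    also have "\<dots> = r\<^sup>2 * (L2_norm \<tau> (\<xi> j))\<^sup>2 + q\<^sup>2"
      unfolding \<zeta>_def L2_norm_lincomb[OF \<xi>M SjM(1)] by (simp add: \<xi>S SjM)
    finally show "(L2_norm \<tau> (\<eta> j))\<^sup>2 \<le> r\<^sup>2 * (L2_norm \<tau> (\<xi> j))\<^sup>2 + q\<^sup>2" .
  qed
  also have "\<dots> = r\<^sup>2 * (\<Sum>j\<in>UNIV. (L2_norm \<tau> (\<xi> j))\<^sup>2) + (1 - r)\<^sup>2 * (real CARD('n) / t)"
    using t by (simp add: sum.distrib sum_distrib_left q_def power_divide)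
  finally show ?thesis by (simp add: Y_def)
qed

section \<open>Norms of conjugate variables and second moments\<close>

lemma conjugate_variables_norms:
  fixes X :: "'n::finite \<Rightarrow> 'h::chilbert_space op"
  assumes M: "tracial_vN_algebra M \<tau>" and X: "sa_tuple M X" and \<xi>: "conjugate_variables \<tau> X \<xi>"
  shows "1 \<le> (L2_norm \<tau> (\<xi> j))\<^sup>2 * Re (\<tau> (X j o\<^sub>L X j))" and "0 < Re (\<tau> (X j o\<^sub>L X j))"
    and "(L2_norm \<tau> (\<lambda>k. \<xi> j k - \<rho> *\<^sub>R X j))\<^sup>2 =
      (L2_norm \<tau> (\<xi> j))\<^sup>2 - 2 * \<rho> + \<rho>\<^sup>2 * Re (\<tau> (X j o\<^sub>L X j))"
proof -
  interpret adj_trace M \<tau> using M by (rule adj_trace_tracial)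
  have XM: "range X \<subseteq> M" and adjX: "adj (X j) = X j" using X by (auto simp: sa_tuple_def)
  have WM: "W_star X \<subseteq> M" using tracial_von_neumann[OF M] XM by (rule vN_generated_subset)
  have \<xi>M: "\<xi> j \<in> L2_vectors \<tau> M"
    and word: "cnj (L2_inner \<tau> (\<xi> j) (\<lambda>_. word_eval X [j])) = word_deriv \<tau> X j [j]"
    using \<xi> L2_vectors_mono[OF WM] unfolding conjugate_variables_iff[OF XM WM] by auto
  \<comment> \<open>The one-letter word has a single splitting, with both legs empty.\<close>
  have "{i. i < length [j] \<and> [j] ! i = j} = {0}" by auto
  with word have "cnj (L2_inner \<tau> (\<xi> j) (\<lambda>_. X j)) = 1"
    by (simp add: word_deriv_def word_eval_eq_op_prod)
  then have one: "Re (L2_inner \<tau> (\<xi> j) (\<lambda>_. X j)) = 1" by (simp add: complex_eq_iff)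
  have XjM: "X j \<in> M" and ip: "ip (X j) (X j) = Re (\<tau> (X j o\<^sub>L X j))"
    using XM adjX by (auto simp: inner2_def)
  from L2_cauchy_schwarz[OF \<xi>M XjM]
  show le: "1 \<le> (L2_norm \<tau> (\<xi> j))\<^sup>2 * Re (\<tau> (X j o\<^sub>L X j))" by (simp add: one ip)
  show "0 < Re (\<tau> (X j o\<^sub>L X j))"
    using le ip.ip_nonneg[OF XjM] unfolding ip by (cases "Re (\<tau> (X j o\<^sub>L X j)) = 0") auto
  show "(L2_norm \<tau> (\<lambda>k. \<xi> j k - \<rho> *\<^sub>R X j))\<^sup>2 =
      (L2_norm \<tau> (\<xi> j))\<^sup>2 - 2 * \<rho> + \<rho>\<^sup>2 * Re (\<tau> (X j o\<^sub>L X j))"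
    using L2_norm_lincomb[OF \<xi>M XjM, of 1 "- \<rho>"] by (simp add: one ip)
qed

section \<open>Bounds for the free entropy\<close>

definition signed_integral :: "(real \<Rightarrow> ereal) \<Rightarrow> ereal" where
  "signed_integral f = enn2ereal (\<integral>\<^sup>+t\<in>{0<..}. e2ennreal (f t) \<partial>lborel) -
     enn2ereal (\<integral>\<^sup>+t\<in>{0<..}. e2ennreal (- f t) \<partial>lborel)"

text \<open>\<open>nn_integral\<close> is monotone on all functions, so a pointwise comparison
  suffices, whatever the measurability of the Fisher information in \<open>t\<close>.\<close>

lemma signed_integral_mono:
  assumes "\<And>t. 0 < t \<Longrightarrow> f t \<le> g t"
  shows "signed_integral f \<le> signed_integral g"
proof -
  have "e2ennreal (f t) * indicator {0<..} t \<le> e2ennreal (g t) * indicator {0<..} t"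
    "e2ennreal (- g t) * indicator {0<..} t \<le> e2ennreal (- f t) * indicator {0<..} t" for t
    using assms[of t] by (auto simp: indicator_def intro: e2ennreal_mono)
  then show ?thesis
    unfolding signed_integral_def
    by (intro ereal_minus_mono) (auto simp: less_eq_ennreal.rep_eq[symmetric] intro!: nn_integral_mono)
qed

lemma nn_integral_reciprocals:
  assumes "0 < b" "b \<le> c" "0 \<le> n"
  shows "(\<integral>\<^sup>+t\<in>{0<..}. ennreal (n / (b + t) - n / (c + t)) \<partial>lborel) = ennreal (n * (ln c - ln b))"
proof -
  \<comment> \<open>Written with one logarithm, the primitive visibly tends to 0 at infinity; its
    derivative is taken from the difference of logarithms.\<close>
  let ?F = "\<lambda>t. n * ln ((b + t) / (c + t))"
  have "(\<integral>\<^sup>+t\<in>{0<..}. ennreal (n / (b + t) - n / (c + t)) \<partial>lborel) =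
      (\<integral>\<^sup>+t\<in>{0..}. ennreal (n / (b + t) - n / (c + t)) \<partial>lborel)"
    by (rule nn_integral_cong_AE) (use AE_lborel_singleton[of 0] in eventually_elim, auto simp: indicator_def)
  also have "\<dots> = ennreal (0 - ?F 0)"
  proof (rule nn_integral_FTC_atLeast)
    show "(\<lambda>t. n / (b + t) - n / (c + t)) \<in> borel_measurable borel" by measurable
    fix t :: real assume t: "0 \<le> t"
    with assms have pos: "0 < b + t" "0 < c + t" by auto
    have "((\<lambda>t. n * (ln (b + t) - ln (c + t))) has_real_derivative n / (b + t) - n / (c + t)) (at t)"
      using pos by (auto intro!: derivative_eq_intros simp: field_simps)
    moreover have "eventually (\<lambda>t. ?F t = n * (ln (b + t) - ln (c + t))) (nhds t)"
    proof -
      have "eventually (\<lambda>t. - b < t) (nhds t)"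
        using t assms by (intro order_tendstoD[OF filterlim_ident]) auto
      then show ?thesis
        by eventually_elim (use assms in \<open>simp add: ln_div\<close>)
    qed
    ultimately show "(?F has_real_derivative n / (b + t) - n / (c + t)) (at t)"
      by (subst DERIV_cong_ev[OF refl _ refl])
    show "0 \<le> n / (b + t) - n / (c + t)"
      using pos assms by (auto intro: divide_left_mono)
  next
    have "((\<lambda>t. (b + t) / (c + t)) \<longlongrightarrow> 1) at_top" by real_asymp
    then have "(?F \<longlongrightarrow> n * ln 1) at_top" by (intro tendsto_intros) auto
    then show "(?F \<longlongrightarrow> 0) at_top" by simp
  qed
  finally show ?thesis using assms by (simp add: ln_div algebra_simps)
qed

text \<open>The integrand has constant sign, so one of its two parts vanishes; which one depends on
  whether \<open>a\<close> is at least 1.\<close>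

lemma signed_integral_reciprocals:
  assumes "0 < a" "0 \<le> n"
  shows "signed_integral (\<lambda>t. ereal (n / (1 + t) - n / (a + t))) = ereal (n * ln a)"
proof -
  have zero: "(\<integral>\<^sup>+t\<in>{0<..}. ennreal (n / (b + t) - n / (c + t)) \<partial>lborel) = 0"
    if "0 < c" "c \<le> b" for b c :: real
  proof -
    have vanish: "ennreal (n / (b + t) - n / (c + t)) * indicator {0<..} t = 0" for t
      using that assms by (auto simp: indicator_def intro!: ennreal_neg divide_left_mono)
    show ?thesis by (simp only: vanish) simp
  qed
  have eq: "signed_integral (\<lambda>t. ereal (n / (1 + t) - n / (a + t))) =
      enn2ereal (\<integral>\<^sup>+t\<in>{0<..}. ennreal (n / (1 + t) - n / (a + t)) \<partial>lborel) -
      enn2ereal (\<integral>\<^sup>+t\<in>{0<..}. ennreal (n / (a + t) - n / (1 + t)) \<partial>lborel)"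
    by (simp add: signed_integral_def e2ennreal_ereal)
  show ?thesis
  proof (cases "1 \<le> a")
    case True
    then show ?thesis unfolding eq
      using assms nn_integral_reciprocals[of 1 a n] zero[of 1 a]
      by (simp add: enn2ereal_ennreal zero_ennreal.rep_eq)
  next
    case False
    then show ?thesis unfolding eq
      using assms nn_integral_reciprocals[of a 1 n] zero[of a 1]
      by (simp add: enn2ereal_ennreal mult_nonneg_nonpos zero_ennreal.rep_eq zero_ereal_def)
  qed
qed

lemma entropy_formula_signed_integral:
  fixes Y S :: "'n::finite \<Rightarrow> 'h::chilbert_space op"
  shows "entropy_formula \<tau> Y S = ereal (1/2) * signed_integral
       (\<lambda>t. ereal (real CARD('n) / (1 + t)) - free_fisher \<tau> (\<lambda>j. Y j + sqrt t *\<^sub>R S j)) +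
     ereal (real CARD('n) / 2 * ln (2 * pi * exp 1))"
  by (simp add: entropy_formula_def signed_integral_def Let_def)

text \<open>n / (a + t) is the Fisher information along the flow started at a free semicircular
  tuple of variance \<open>a\<close>, and the bound is the entropy of that tuple.\<close>

lemma entropy_formula_ge:
  fixes Y S :: "'n::finite \<Rightarrow> 'h::chilbert_space op"
  assumes "0 < a" and fisher: "\<And>t. 0 < t \<Longrightarrow>
    free_fisher \<tau> (\<lambda>j. Y j + sqrt t *\<^sub>R S j) \<le> ereal (real CARD('n) / (a + t))"
  shows "ereal (real CARD('n) / 2 * (ln a + ln (2 * pi * exp 1))) \<le> entropy_formula \<tau> Y S"
proof -
  let ?n = "real CARD('n)"
  have "ereal (?n * ln a) = signed_integral (\<lambda>t. ereal (?n / (1 + t) - ?n / (a + t)))"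
    using assms by (simp add: signed_integral_reciprocals)
  also have "\<dots> \<le> signed_integral
      (\<lambda>t. ereal (?n / (1 + t)) - free_fisher \<tau> (\<lambda>j. Y j + sqrt t *\<^sub>R S j))"
    unfolding ereal_minus(1)[symmetric] by (intro signed_integral_mono ereal_minus_mono fisher order_refl)
  finally have "ereal (1/2) * ereal (?n * ln a) + ereal (?n / 2 * ln (2 * pi * exp 1)) \<le> entropy_formula \<tau> Y S"
    unfolding entropy_formula_signed_integral by (intro add_right_mono ereal_mult_left_mono) auto
  then show ?thesis by (simp add: algebra_simps)
qed

lemma entropy_formula_le:
  fixes Y S :: "'n::finite \<Rightarrow> 'h::chilbert_space op"
  assumes "0 < a" and fisher: "\<And>t. 0 < t \<Longrightarrow>
    ereal (real CARD('n) / (a + t)) \<le> free_fisher \<tau> (\<lambda>j. Y j + sqrt t *\<^sub>R S j)"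
  shows "entropy_formula \<tau> Y S \<le> ereal (real CARD('n) / 2 * (ln a + ln (2 * pi * exp 1)))"
proof -
  let ?n = "real CARD('n)"
  have "signed_integral (\<lambda>t. ereal (?n / (1 + t)) - free_fisher \<tau> (\<lambda>j. Y j + sqrt t *\<^sub>R S j)) \<le>
      signed_integral (\<lambda>t. ereal (?n / (1 + t) - ?n / (a + t)))"
    unfolding ereal_minus(1)[symmetric] by (intro signed_integral_mono ereal_minus_mono fisher order_refl)
  also have "\<dots> = ereal (?n * ln a)"
    using assms by (simp add: signed_integral_reciprocals)
  finally have "entropy_formula \<tau> Y S \<le> ereal (1/2) * ereal (?n * ln a) + ereal (?n / 2 * ln (2 * pi * exp 1))"
    unfolding entropy_formula_signed_integral by (intro add_right_mono ereal_mult_left_mono) auto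
  then show ?thesis by (simp add: algebra_simps)
qed

lemma free_fisher_ge:
  fixes X :: "'n::finite \<Rightarrow> 'h::chilbert_space op"
  assumes "tracial_vN_algebra M \<tau>" "sa_tuple M X"
  shows "ereal (\<Sum>j\<in>UNIV. 1 / Re (\<tau> (X j o\<^sub>L X j))) \<le> free_fisher \<tau> X"
proof -
  have "(\<Sum>j\<in>UNIV. 1 / Re (\<tau> (X j o\<^sub>L X j))) \<le> (\<Sum>j\<in>UNIV. (L2_norm \<tau> (\<xi> j))\<^sup>2)"
    if "conjugate_variables \<tau> X \<xi>" for \<xi>
  proof (rule sum_mono)
    fix j
    let ?v = "Re (\<tau> (X j o\<^sub>L X j))"
    have "1 \<le> (L2_norm \<tau> (\<xi> j))\<^sup>2 * ?v" "0 < ?v"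
      using assms that by (rule conjugate_variables_norms)+
    then show "1 / ?v \<le> (L2_norm \<tau> (\<xi> j))\<^sup>2" by (simp add: divide_le_eq)
  qed
  then show ?thesis
    by (auto simp: free_fisher_def intro!: INF_greatest)
qed

text \<open>Freeness and \<open>\<tau> (S j) = 0\<close> remove the mixed terms, so second moments
  add along the flow.\<close>

lemma free_fisher_perturbed_ge:
  fixes Y S :: "'n::finite \<Rightarrow> 'h::chilbert_space op"
  assumes M: "tracial_vN_algebra M \<tau>" and Y: "sa_tuple M Y"
    and S: "free_semicircular_tuple M \<tau> 1 S" and free: "free_tuples \<tau> Y S"
    and v: "\<And>j. \<tau> (Y j o\<^sub>L Y j) = of_real v" and "0 \<le> t"
  shows "ereal (real CARD('n) / (v + t)) \<le> free_fisher \<tau> (\<lambda>j. Y j + sqrt t *\<^sub>R S j)"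
proof -
  interpret adj_trace M \<tau> using M by (rule adj_trace_tracial)
  have YM: "Y j \<in> M" "adj (Y j) = Y j" for j using Y by (auto simp: sa_tuple_def)
  note SM = free_semicircular_tupleD[OF S]
  have YS: "\<tau> (Y j o\<^sub>L S j) = 0" for j
    using M _ S free
    by (rule free_semicircular_orthogonal) (use YM vN_generated_superset in blast)+
  have trace: "Re (\<tau> ((Y j + sqrt t *\<^sub>R S j) o\<^sub>L (Y j + sqrt t *\<^sub>R S j))) = v + t" for j
  proof -
    have "\<tau> ((Y j + sqrt t *\<^sub>R S j) o\<^sub>L (Y j + sqrt t *\<^sub>R S j)) =
        \<tau> (Y j o\<^sub>L Y j) + sqrt t * \<tau> (Y j o\<^sub>L S j) + sqrt t * (\<tau> (S j o\<^sub>L Y j) + sqrt t * \<tau> (S j o\<^sub>L S j))"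
      unfolding scale_op_of_real[symmetric]
      using YM SM by (simp add: compose_linear[OF algebra_M] linear_onD[OF linear_trace]) (simp add: algebra_simps)
    also have "\<dots> = of_real (v + t)"
      using trace_commute[OF SM(1) YM(1)] SM(5) \<open>0 \<le> t\<close>
      by (simp add: YS v flip: of_real_mult)
    finally show ?thesis by simp
  qed
  have "sa_tuple M (\<lambda>j. Y j + sqrt t *\<^sub>R S j)"
    using YM SM by (simp add: sa_tuple_def adj_add adj_scaleR)
  from free_fisher_ge[OF M this] show ?thesis unfolding trace by simp
qed

text \<open>The supremum runs over realizations on other algebras, which share with the given tuple
  only its moments; the word \<open>[j, j]\<close> supplies the second moment that enters the
  bound.\<close>

lemma free_entropy_scaled_semicircular_le:
  fixes S :: "'n::finite \<Rightarrow> 'h::chilbert_space op"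
  assumes S: "free_semicircular_tuple M \<tau> 1 S" and M: "tracial_vN_algebra M \<tau>" and "0 < v"
  shows "free_entropy \<tau> (\<lambda>j. sqrt v *\<^sub>R S j) \<le>
    ereal (real CARD('n) / 2 * (ln v + ln (2 * pi * exp 1)))"
  unfolding free_entropy_def
proof (rule Sup_least, clarify)
  fix N :: "'h op set" and \<sigma> and Y S' :: "'n \<Rightarrow> 'h op"
  assume N: "tracial_vN_algebra N \<sigma>" "sa_tuple N Y" "free_semicircular_tuple N \<sigma> 1 S'" "free_tuples \<sigma> Y S'"
    and law: "\<forall>w. \<sigma> (word_eval Y w) = \<tau> (word_eval (\<lambda>j. sqrt v *\<^sub>R S j) w)"
  interpret adj_trace M \<tau> using M by (rule adj_trace_tracial)
  have "\<sigma> (Y j o\<^sub>L Y j) = of_real v" for j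
  proof -
    have Sj: "S j \<in> M" "\<tau> (S j o\<^sub>L S j) = 1"
      using free_semicircular_tupleD[OF S] by auto
    have "\<sigma> (Y j o\<^sub>L Y j) = \<tau> (sqrt v *\<^sub>R S j o\<^sub>L sqrt v *\<^sub>R S j)"
      using law[rule_format, of "[j, j]"] by (simp add: word_eval_eq_op_prod)
    also have "\<dots> = of_real v"
      using Sj \<open>0 < v\<close> unfolding scale_op_of_real[symmetric]
      by (simp add: compose_scale_op trace_scale flip: of_real_mult)
    finally show ?thesis .
  qed
  with N \<open>0 < v\<close> show "entropy_formula \<sigma> Y S' \<le> ereal (real CARD('n) / 2 * (ln v + ln (2 * pi * exp 1)))"
    by (intro entropy_formula_le free_fisher_perturbed_ge) auto
qed

text \<open>\<open>M\<close> with X and S is itself an admissible realization in the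
  supremum.\<close>

lemma free_entropy_ge:
  fixes X S :: "'n::finite \<Rightarrow> 'h::chilbert_space op"
  assumes M: "tracial_vN_algebra M \<tau>" and X: "sa_tuple M X"
    and S: "free_semicircular_tuple M \<tau> 1 S" and free: "free_tuples \<tau> X S"
    and F: "free_fisher \<tau> X = ereal F" "0 < F"
  shows "ereal (real CARD('n) / 2 * (ln (real CARD('n) / F) + ln (2 * pi * exp 1))) \<le> free_entropy \<tau> X"
proof -
  let ?n = "real CARD('n)"
  define a where "a = ?n / F"
  have a: "0 < a" "?n = a * F" using F by (auto simp: a_def)
  have "ereal (?n / 2 * (ln a + ln (2 * pi * exp 1))) \<le> entropy_formula \<tau> X S"
  proof (rule entropy_formula_ge)
    fix t :: real assume t: "0 < t"
    \<comment> \<open>The minimizer of r^2 F + (1 - r)^2 n / t, where n = a F; the minimum is n / (a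
      + t).\<close>
    define r where "r = a / (a + t)"
    have r: "0 < r" "1 - r = t / (a + t)" using a t by (auto simp: r_def field_simps)
    have "r\<^sup>2 * F + (1 - r)\<^sup>2 * (?n / t) = ?n / (a + t)"
    proof -
      have "r\<^sup>2 * F + (1 - r)\<^sup>2 * (?n / t) = ?n * (a + t) / (a + t)\<^sup>2"
        unfolding r(2) using a t by (simp add: r_def field_simps power2_eq_square) (simp add: add_divide_distrib)
      then show ?thesis using a t by (simp add: power2_eq_square)
    qed
    moreover have "free_fisher \<tau> (\<lambda>j. X j + sqrt t *\<^sub>R S j) \<le> ereal (r\<^sup>2 * F + (1 - r)\<^sup>2 * (?n / t))"
    \<comment> \<open>F is an infimum over conjugate variables; working up to \<open>e\<close>
      avoids showing that all of them have the same norm. Dividing by r^2 compensates the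
      coefficient in Stam's bound.\<close>
    proof (rule ereal_le_epsilon2)
      fix e :: real assume "0 < e"
      with r have "free_fisher \<tau> X < ereal (F + e / r\<^sup>2)" by (simp add: F)
      then obtain \<xi> where \<xi>: "conjugate_variables \<tau> X \<xi>"
        "(\<Sum>j\<in>UNIV. (L2_norm \<tau> (\<xi> j))\<^sup>2) < F + e / r\<^sup>2"
        by (auto simp: free_fisher_def INF_less_iff split: if_splits)
      have "free_fisher \<tau> (\<lambda>j. X j + sqrt t *\<^sub>R S j) \<le>
          ereal (r\<^sup>2 * (\<Sum>j\<in>UNIV. (L2_norm \<tau> (\<xi> j))\<^sup>2) + (1 - r)\<^sup>2 * (?n / t))"
        using M X S free \<xi>(1) t by (rule free_stam_inequality)
      also have "r\<^sup>2 * (\<Sum>j\<in>UNIV. (L2_norm \<tau> (\<xi> j))\<^sup>2) \<le> r\<^sup>2 * (F + e / r\<^sup>2)"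
        using \<xi>(2) by (intro mult_left_mono) auto
      also have "r\<^sup>2 * (F + e / r\<^sup>2) = r\<^sup>2 * F + e" using r by (simp add: distrib_left)
      finally show "free_fisher \<tau> (\<lambda>j. X j + sqrt t *\<^sub>R S j) \<le>
          ereal (r\<^sup>2 * F + (1 - r)\<^sup>2 * (?n / t)) + ereal e" by (simp add: algebra_simps)
    qed
    ultimately show "free_fisher \<tau> (\<lambda>j. X j + sqrt t *\<^sub>R S j) \<le> ereal (?n / (a + t))" by simp
  qed (rule a)
  also have "\<dots> \<le> free_entropy \<tau> X"
    unfolding free_entropy_def using M X S free by (intro Sup_upper) blast
  finally show ?thesis by (simp add: a_def)
qed

theorem theorem6p1:
  fixes M :: "'h::chilbert_space op set"
    and \<tau> :: "'h op \<Rightarrow> complex"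
    and X S :: "'n::finite \<Rightarrow> 'h op"
    and \<rho> :: real
  assumes "tracial_vN_algebra M \<tau>"
    and "sa_tuple M X"
    and "free_semicircular_tuple M \<tau> 1 S"
    and "free_tuples \<tau> X S"
    and "\<rho> > 0"
  shows "rel_free_fisher \<rho> \<tau> X
           - ereal (2 * \<rho>) * entropy_gap \<rho> \<tau> X (\<lambda>j. (1 / sqrt \<rho>) *\<^sub>R S j)
         \<ge> ereal (real CARD('n) * \<rho>) * d_fun (free_fisher \<tau> X / ereal (real CARD('n) * \<rho>) - 1)"
proof (cases "\<exists>\<xi>. conjugate_variables \<tau> X \<xi>")
  \<comment> \<open>The relative Fisher information is infinite, and in \<open>ereal\<close>
    subtracting anything from infinity gives infinity.\<close>
  case False
  then show ?thesis by (simp add: rel_free_fisher_def minus_ereal_def)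
next
  case True
  then obtain \<xi> where \<xi>: "conjugate_variables \<tau> X \<xi>" ..
  define n where "n = real CARD('n)"
  define v where "v j = Re (\<tau> (X j o\<^sub>L X j))" for j
  define V where "V = (\<Sum>j\<in>UNIV. v j)"
  define c where "c = ln (2 * pi * exp (1::real))"
  let ?Z = "\<lambda>j. (1 / sqrt \<rho>) *\<^sub>R S j"
  note norms = conjugate_variables_norms[OF assms(1,2)]
  interpret adj_trace M \<tau> using assms(1) by (rule adj_trace_tracial)
  have n: "0 < n" by (simp add: n_def)
  have v: "0 < v j" for j
    unfolding v_def using \<xi> by (rule norms(2))
  \<comment> \<open>Makes F positive, so that the logarithm of n / F behaves as expected.\<close>
  have "0 < (\<Sum>j\<in>(UNIV :: 'n set). 1 / v j)" using v by (intro sum_pos) auto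
  moreover have "ereal (\<Sum>j\<in>UNIV. 1 / v j) \<le> free_fisher \<tau> X"
    using free_fisher_ge[OF assms(1,2)] by (simp add: v_def)
  moreover have "free_fisher \<tau> X \<le> ereal (\<Sum>j\<in>UNIV. (L2_norm \<tau> (\<xi> j))\<^sup>2)"
    using \<xi> by (auto simp: free_fisher_def intro: INF_lower)
  ultimately obtain F where F: "free_fisher \<tau> X = ereal F" "0 < F"
    by (cases "free_fisher \<tau> X") auto
  \<comment> \<open>Shown for each \<xi> separately, since the two infima are not known to share a
    minimizer.\<close>
  have fisher: "ereal (F - 2 * \<rho> * n + \<rho>\<^sup>2 * V) \<le> rel_free_fisher \<rho> \<tau> X"
  proof -
    have "F - 2 * \<rho> * n + \<rho>\<^sup>2 * V \<le> (\<Sum>j\<in>UNIV. (L2_norm \<tau> (\<lambda>k. \<xi> j k - \<rho> *\<^sub>R X j))\<^sup>2)"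
      if "conjugate_variables \<tau> X \<xi>" for \<xi>
    proof -
      have "ereal F \<le> ereal (\<Sum>j\<in>UNIV. (L2_norm \<tau> (\<xi> j))\<^sup>2)"
        unfolding F(1)[symmetric] free_fisher_def using that by (auto intro: INF_lower)
      then show ?thesis
        unfolding norms(3)[OF that]
        by (simp add: V_def v_def n_def sum.distrib sum_subtractf sum_distrib_left)
    qed
    then show ?thesis
      using True by (auto simp: rel_free_fisher_def intro!: INF_greatest)
  qed
  have "\<tau> (?Z j o\<^sub>L ?Z j) = of_real (1 / \<rho>)" for j
  proof -
    have "S j \<in> M" "\<tau> (S j o\<^sub>L S j) = 1"
      using free_semicircular_tupleD[OF assms(3)] by auto
    then show ?thesis
      using \<open>0 < \<rho>\<close> unfolding scale_op_of_real[symmetric]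
      by (simp add: compose_scale_op trace_scale flip: of_real_mult)
  qed
  then have Z2: "(\<Sum>j\<in>UNIV. Re (\<tau> (?Z j o\<^sub>L ?Z j))) = n / \<rho>"
    by (simp add: n_def)
  have "free_entropy \<tau> ?Z \<le> ereal (n / 2 * (ln (1 / \<rho>) + c))"
    using free_entropy_scaled_semicircular_le[OF assms(3,1), of "1 / \<rho>"] \<open>0 < \<rho>\<close>
    by (simp add: real_sqrt_divide n_def c_def)
  then have relZ: "ereal (\<rho> / 2 * (n / \<rho>)) - ereal (n / 2 * (ln (1 / \<rho>) + c)) \<le> rel_free_entropy \<rho> \<tau> ?Z"
    unfolding rel_free_entropy_def Z2 by (intro ereal_minus_mono order_refl)
  have "ereal (n / 2 * (ln (n / F) + c)) \<le> free_entropy \<tau> X"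
    using free_entropy_ge[OF assms(1-4) F] by (simp add: n_def c_def)
  then have "rel_free_entropy \<rho> \<tau> X \<le> ereal (\<rho> / 2 * V) - ereal (n / 2 * (ln (n / F) + c))"
    unfolding rel_free_entropy_def V_def v_def by (intro ereal_minus_mono order_refl)
  with relZ have "entropy_gap \<rho> \<tau> X ?Z \<le>
      (ereal (\<rho> / 2 * V) - ereal (n / 2 * (ln (n / F) + c))) -
      (ereal (\<rho> / 2 * (n / \<rho>)) - ereal (n / 2 * (ln (1 / \<rho>) + c)))"
    unfolding entropy_gap_def by (intro ereal_minus_mono)
  then have "ereal (2 * \<rho>) * entropy_gap \<rho> \<tau> X ?Z \<le> ereal (2 * \<rho>) *
      ((ereal (\<rho> / 2 * V) - ereal (n / 2 * (ln (n / F) + c))) -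
      (ereal (\<rho> / 2 * (n / \<rho>)) - ereal (n / 2 * (ln (1 / \<rho>) + c))))"
    using \<open>0 < \<rho>\<close> by (intro ereal_mult_left_mono) auto
  also have "\<dots> = ereal (\<rho>\<^sup>2 * V - n * \<rho> * ln (n / F) - n * \<rho> + n * \<rho> * ln (1 / \<rho>))"
    using \<open>0 < \<rho>\<close> by (simp add: field_simps power2_eq_square)
  finally have "ereal (F - 2 * \<rho> * n + \<rho>\<^sup>2 * V) -
      ereal (\<rho>\<^sup>2 * V - n * \<rho> * ln (n / F) - n * \<rho> + n * \<rho> * ln (1 / \<rho>)) \<le>
      rel_free_fisher \<rho> \<tau> X - ereal (2 * \<rho>) * entropy_gap \<rho> \<tau> X ?Z"
    using fisher by (intro ereal_minus_mono)
  moreover have "ereal (n * \<rho>) * d_fun (free_fisher \<tau> X / ereal (n * \<rho>) - 1) =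
      ereal (n * \<rho> * (F / (n * \<rho>) - 1 - ln (F / (n * \<rho>))))"
    using n \<open>0 < \<rho>\<close> by (simp add: F d_fun_def one_ereal_def)
  \<comment> \<open>The second moments \<open>V\<close> cancel, and log (n / F) - log (1 / \<rho>) =
    - log (F / (n \<rho>)).\<close>
  moreover have "n * \<rho> * (F / (n * \<rho>) - 1 - ln (F / (n * \<rho>))) =
      F - 2 * \<rho> * n + \<rho>\<^sup>2 * V - (\<rho>\<^sup>2 * V - n * \<rho> * ln (n / F) - n * \<rho> + n * \<rho> * ln (1 / \<rho>))"
    using n F(2) \<open>0 < \<rho>\<close> by (simp add: ln_div ln_mult field_simps)
  ultimately show ?thesis by (simp add: n_def)
qed

end
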